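(* Let $0<\delta\le 0.1$ be an arbitrary absolute constant, let $\theta\in(0,1)$, and let $d,k\in\mathbb{N}$ with $d\ge k$. Consider the model $\mathrm{NegSPCA}_\theta$, with family $\mathcal S=\{N(0,\mathrm{Id}_{d+1}-\theta xx^\top)\}$ indexed by the spike vector $x$, with $\mu$ the prior distribution of $x$, and with null distribution $N(0,\mathrm{Id}_{d+1})$. Then, for $n=o(\min(d/k^{\delta},k^{2-2\delta}))$ (asymptotics as $n\to\infty$, with $d=d(n)$, $k=k(n)$), the statistical dimension satisfies $$\mathrm{SDA}(\mathcal S,\mu,n)\ge 2^{k^{\delta}}.$$
   Context: **Prior on the spike.** $\mu$ is the law of the unit vector $x\in\mathbb{R}^{d+1}$ with first coordinate $x_1=-\frac1{\sqrt{k+1}}$ and remaining coordinates $x_{\setminus1}$ uniform over the vectors in $\{\pm\frac1{\sqrt{k+1}},0\}^d$ with exactly $k$ non-zero entries. The model $\mathrm{NegSPCA}_\theta$ asks to distinguish the planted distribution $N(0,\mathrm{Id}_{d+1}-\theta xx^\top)$, $x\sim\mu$ drawn once and fixed, from the null distribution $N(0,\mathrm{Id}_{d+1})$. **Statistical dimension.** Let $D_\emptyset$ be the density of the null distribution and $D_u$ the density of the member of $\mathcal S$ indexed by $u$. Put $\bar D_u=D_u/D_\emptyset$ and $\langle f,g\rangle=\mathbb{E}_{z\sim D_\emptyset}[f(z)g(z)]$. Then $$\mathrm{SDA}(\mathcal S,\mu,n)=\max\Big\{q\in\mathbb{N}:\ \mathbb{E}_{u,v\sim\mu}\big[\,|\langle\bar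 D_u,\bar D_v\rangle-1|\ \big|\ E\big]\le\tfrac1n\ \text{ for all events } E \text{ with } \Pr_{u,v\sim\mu}(E)\ge\tfrac1{q^2}\Big\},$$ where $u,v$ are drawn independently from $\mu$. The asymptotic statement is understood for all sufficiently large $n$. *)

theory Defs
  imports
    "HOL-Probability.Probability"
    "HOL-Library.Landau_Symbols"
    "Jordan_Normal_Form.Gauss_Jordan_Elimination"
    "Jordan_Normal_Form.Determinant"
begin

(* HOL-Analysis and Jordan_Normal_Form both use these symbols;
   below they always refer to the vectors of Jordan_Normal_Form. *)
no_notation inner (infix \<open>\<bullet>\<close> 70)
no_notation vec_nth (infixl \<open>$\<close> 90)

(* The dimension m varies with the sample size, so a point of R^m is a function in
   extensional {..<m}, carrying the product Lebesgue measure; it is turned into a vector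
   of dimension m when linear algebra is needed. *)
definition lebesgue_space :: "nat \<Rightarrow> (nat \<Rightarrow> real) measure" where
  "lebesgue_space m = Pi\<^sub>M {..<m} (\<lambda>_. lborel)"

(* Density of N(0, C); meaningful for symmetric positive definite C. *)
definition gaussian_density :: "real mat \<Rightarrow> (nat \<Rightarrow> real) \<Rightarrow> real" where
  "gaussian_density C z =
     (let m = dim_row C; x = Matrix.vec m z in
      exp (- (x \<bullet> (the (mat_inverse C) *\<^sub>v x)) / 2) / sqrt ((2 * pi) ^ m * Determinant.det C))"

(* M is the reference measure, D0 the null density, D the indexed family of densities. *)
definition likelihood_corr ::
  "'z measure \<Rightarrow> ('z \<Rightarrow> real) \<Rightarrow> ('u \<Rightarrow> 'z \<Rightarrow> real) \<Rightarrow> 'u \<Rightarrow> 'u \<Rightarrow> real" where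
  "likelihood_corr M D0 D u v = (\<integral>z. (D u z / D0 z) * (D v z / D0 z) \<partial>(density M D0))"

(* q = 0 is excluded, because 1 / 0 = 0 in HOL and a null event has no conditional law.
   The value is unspecified if there is no largest such q. *)
definition SDA ::
  "'z measure \<Rightarrow> ('z \<Rightarrow> real) \<Rightarrow> ('u \<Rightarrow> 'z \<Rightarrow> real) \<Rightarrow> 'u pmf \<Rightarrow> nat \<Rightarrow> nat" where
  "SDA M D0 D \<mu> n = Max {q :: nat. 0 < q \<and>
     (\<forall>E. measure_pmf.prob (pair_pmf \<mu> \<mu>) E \<ge> 1 / (real q)\<^sup>2 \<longrightarrow>
        measure_pmf.expectation (cond_pmf (pair_pmf \<mu> \<mu>) E)
          (\<lambda>(u, v). \<bar>likelihood_corr M D0 D u v - 1\<bar>) \<le> 1 / real n)}"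

definition sparse_sign_vectors :: "nat \<Rightarrow> nat \<Rightarrow> real Matrix.vec set" where
  "sparse_sign_vectors d k = {y \<in> carrier_vec d.
     (\<forall>i<d. y $ i \<in> {1 / sqrt (real k + 1), - 1 / sqrt (real k + 1), 0}) \<and>
     card {i. i < d \<and> y $ i \<noteq> 0} = k}"

definition spike_prior :: "nat \<Rightarrow> nat \<Rightarrow> real Matrix.vec pmf" where
  "spike_prior d k =
     map_pmf (vCons (- 1 / sqrt (real k + 1))) (pmf_of_set (sparse_sign_vectors d k))"

definition spiked_covariance :: "real \<Rightarrow> real Matrix.vec \<Rightarrow> real mat" where
  "spiked_covariance \<theta> x =
     1\<^sub>m (dim_vec x) - \<theta> \<cdot>\<^sub>m Matrix.mat (dim_vec x) (dim_vec x) (\<lambda>(i, j). x $ i * x $ j)"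

definition NegSPCA_SDA :: "real \<Rightarrow> nat \<Rightarrow> nat \<Rightarrow> nat \<Rightarrow> nat" where
  "NegSPCA_SDA \<theta> d k n =
     SDA (lebesgue_space (d + 1)) (gaussian_density (1\<^sub>m (d + 1)))
       (\<lambda>x. gaussian_density (spiked_covariance \<theta> x)) (spike_prior d k) n"

end

theory Submission
  imports Defs
begin

text \<open>Integrating out the null Gaussian gives
  \<open>\<langle>D\<^sub>u, D\<^sub>v\<rangle> = 1 / sqrt (1 - \<theta>\<^sup>2 (u \<bullet> v)\<^sup>2)\<close>, so the correlation exceeds 1 by at most a constant times
  \<open>(u \<bullet> v)\<^sup>2\<close>. Up to the factor \<open>k + 1\<close>, the overlap \<open>u \<bullet> v\<close> is 1 plus a sum of independent signs over
  the intersection of two random \<open>k\<close>-sets, and its exponential moment at \<open>t\<close> is at most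
  \<open>2 exp (t + (cosh t - 1) k\<^sup>2 / d)\<close>. Conditioning on an event of probability about \<open>exp (- 2 K)\<close>, where
  \<open>K = k\<^sup>\<delta>\<close>, costs only a factor \<open>exp (2 K)\<close> in this moment; the choice
  \<open>t = min 1 (sqrt (K d) / k)\<close> bounds the conditional second moment of the overlap by a constant
  times \<open>max (K / d) (K\<^sup>2 / k\<^sup>2)\<close>. The maximum in the definition of SDA exists because the diagonal
  event \<open>u = v = u\<^sub>0\<close> has positive probability and correlation bounded away from 1.\<close>

subsection \<open>Densities of the spiked Gaussians\<close>

text \<open>Sylvester's determinant identity: the block matrix with rows (1, A) and (C, 1) factors
  both as \<open>?L * ?R1\<close> and as \<open>?R2 * ?L\<close> with the same unit lower triangular
  \<open>?L\<close>. For m = 1 it reduces a rank-one perturbation of the identity to a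
  scalar.\<close>

lemma det_one_minus_mult_commute:
  fixes A C :: "'a :: idom mat"
  assumes A: "A \<in> carrier_mat n m" and C: "C \<in> carrier_mat m n"
  shows "Determinant.det (1\<^sub>m n - A * C) = Determinant.det (1\<^sub>m m - C * A)"
proof -
  let ?M = "four_block_mat (1\<^sub>m n) A C (1\<^sub>m m)"
  let ?L = "four_block_mat (1\<^sub>m n) (0\<^sub>m n m) C (1\<^sub>m m)"
  let ?R1 = "four_block_mat (1\<^sub>m n) A (0\<^sub>m m n) (1\<^sub>m m - C * A)"
  let ?R2 = "four_block_mat (1\<^sub>m n - A * C) A (0\<^sub>m m n) (1\<^sub>m m)"
  have AC: "A * C \<in> carrier_mat n n" and CA: "C * A \<in> carrier_mat m m"
    using A C by auto
  have sub: "1\<^sub>m n - A * C \<in> carrier_mat n n" "1\<^sub>m m - C * A \<in> carrier_mat m m"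
    using AC CA by (auto intro: minus_carrier_mat)
  have cancel: "1\<^sub>m n - A * C + A * C = 1\<^sub>m n" "C * A + (1\<^sub>m m - C * A) = 1\<^sub>m m"
    using A C by (auto intro!: eq_matI)
  have "?L * ?R1 = four_block_mat (1\<^sub>m n * 1\<^sub>m n + 0\<^sub>m n m * 0\<^sub>m m n) (1\<^sub>m n * A + 0\<^sub>m n m * (1\<^sub>m m - C * A))
     (C * 1\<^sub>m n + 1\<^sub>m m * 0\<^sub>m m n) (C * A + 1\<^sub>m m * (1\<^sub>m m - C * A))"
    by (rule mult_four_block_mat) (use A C sub in auto)
  also have "\<dots> = ?M"
    using A C sub cancel by simp
  finally have 1: "?M = ?L * ?R1" ..
  have "?R2 * ?L = four_block_mat ((1\<^sub>m n - A * C) * 1\<^sub>m n + A * C) ((1\<^sub>m n - A * C) * 0\<^sub>m n m + A * 1\<^sub>m m)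
     (0\<^sub>m m n * 1\<^sub>m n + 1\<^sub>m m * C) (0\<^sub>m m n * 0\<^sub>m n m + 1\<^sub>m m * 1\<^sub>m m)"
    by (rule mult_four_block_mat) (use A C sub in auto)
  also have "\<dots> = ?M"
    using A C sub cancel by simp
  finally have 2: "?M = ?R2 * ?L" ..
  have car: "?L \<in> carrier_mat (n+m) (n+m)" "?R1 \<in> carrier_mat (n+m) (n+m)" "?R2 \<in> carrier_mat (n+m) (n+m)"
    using A C sub by (auto intro: four_block_carrier_mat)
  have L: "Determinant.det ?L = 1"
    using C by (subst det_four_block_mat_upper_right_zero[of _ n _ m]) auto
  have R1: "Determinant.det ?R1 = Determinant.det (1\<^sub>m m - C * A)"
    using A sub by (subst det_four_block_mat_lower_left_zero[of _ n _ m]) auto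
  have R2: "Determinant.det ?R2 = Determinant.det (1\<^sub>m n - A * C)"
    using A sub by (subst det_four_block_mat_lower_left_zero[of _ n _ m]) auto
  have "Determinant.det ?L * Determinant.det ?R1 = Determinant.det ?R2 * Determinant.det ?L"
    using 1 2 det_mult[OF car(1,2)] det_mult[OF car(3,1)] by simp
  then show ?thesis
    by (simp add: L R1 R2)
qed

lemma spiked_covariance_carrier [simp]:
  "spiked_covariance \<theta> x \<in> carrier_mat (dim_vec x) (dim_vec x)"
  by (auto simp: spiked_covariance_def)

lemma spiked_covariance_0: "spiked_covariance 0 x = 1\<^sub>m (dim_vec x)"
  by (auto simp: spiked_covariance_def intro!: eq_matI)

lemma det_spiked_covariance:
  "Determinant.det (spiked_covariance \<theta> x) = 1 - \<theta> * (x \<bullet> x)"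
proof -
  define n where "n = dim_vec x"
  define A where "A = mat_of_cols n [\<theta> \<cdot>\<^sub>v x]"
  define C where "C = mat_of_rows n [x]"
  have AC: "A \<in> carrier_mat n 1" "C \<in> carrier_mat 1 n"
    by (auto simp: A_def C_def)
  have "spiked_covariance \<theta> x = 1\<^sub>m n - A * C"
    by (intro eq_matI)
      (auto simp: spiked_covariance_def A_def C_def n_def scalar_prod_def
        mat_of_cols_def mat_of_rows_def)
  then have "Determinant.det (spiked_covariance \<theta> x) = Determinant.det (1\<^sub>m 1 - C * A)"
    using det_one_minus_mult_commute[OF AC] by simp
  also have "\<dots> = (1\<^sub>m 1 - C * A) $$ (0,0)"
    by (rule det_single) (use AC in auto)
  also have "\<dots> = 1 - \<theta> * (x \<bullet> x)"
    by (auto simp: A_def C_def n_def scalar_prod_def sum_distrib_left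
        mat_of_cols_def mat_of_rows_def mult_ac intro!: sum.cong)
  finally show ?thesis .
qed

text \<open>For a unit vector the matrix P of entries \<open>x $ i * x $ j\<close> is idempotent, so
  (1 - aP)(1 - bP) = 1 - (a + b - ab)P. The inverse of a spiked covariance is therefore spiked along
  the same direction.\<close>

lemma spiked_covariance_mult:
  assumes "x \<bullet> x = 1"
  shows "spiked_covariance a x * spiked_covariance b x = spiked_covariance (a + b - a * b) x"
proof (intro eq_matI)
  fix i j assume "i < dim_row (spiked_covariance (a + b - a * b) x)" "j < dim_col (spiked_covariance (a + b - a * b) x)"
  then have ij: "i < dim_vec x" "j < dim_vec x"
    by (auto simp: spiked_covariance_def)
  let ?I = "\<lambda>i j. if i = j then 1 else 0 :: real"
  have "(spiked_covariance a x * spiked_covariance b x) $$ (i,j)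
      = (\<Sum>l\<in>{0..<dim_vec x}. (?I i l - a * (x $ i * x $ l)) * (?I l j - b * (x $ l * x $ j)))"
    using ij by (auto simp: spiked_covariance_def scalar_prod_def intro!: sum.cong)
  also have "\<dots> = (\<Sum>l\<in>{0..<dim_vec x}. ?I i l * ?I l j) - (\<Sum>l\<in>{0..<dim_vec x}. ?I i l * (b * (x $ l * x $ j)))
      - (\<Sum>l\<in>{0..<dim_vec x}. ?I l j * (a * (x $ i * x $ l))) + a * b * x $ i * x $ j * (x \<bullet> x)"
    by (auto simp: scalar_prod_def algebra_simps sum.distrib sum_subtractf sum_distrib_left intro!: sum.cong)
  also have "\<dots> = ?I i j - b * (x $ i * x $ j) - a * (x $ i * x $ j) + a * b * x $ i * x $ j"
    using ij assms by (simp add: if_distrib[of "\<lambda>u. u * _"] if_distrib[of "\<lambda>u. _ * u"] sum.delta sum.delta' cong: if_cong)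
  also have "\<dots> = spiked_covariance (a + b - a * b) x $$ (i,j)"
    using ij by (auto simp: spiked_covariance_def algebra_simps)
  finally show "(spiked_covariance a x * spiked_covariance b x) $$ (i,j) = \<dots>" .
qed (auto simp: spiked_covariance_def)

text \<open>\<open>mat_inverse\<close> returns an option. \<open>None\<close> would contradict that
  \<open>C\<close> is a unit of the matrix ring, and any returned inverse equals \<open>B\<close> by
  uniqueness of two-sided inverses.\<close>

lemma the_mat_inverse_eq:
  fixes C :: "'a :: field mat"
  assumes C: "C \<in> carrier_mat n n" and B: "B \<in> carrier_mat n n"
    and CB: "C * B = 1\<^sub>m n" and BC: "B * C = 1\<^sub>m n"
  shows "the (mat_inverse C) = B"
proof (cases "mat_inverse C")
  case None
  have "C \<in> Units (ring_mat TYPE('a) n ())"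
    using assms unfolding Units_def by (auto simp: ring_mat_simps)
  with mat_inverse(1)[OF C None, of "()"] show ?thesis by blast
next
  case (Some B')
  from mat_inverse(2)[OF C Some]
  have B': "C * B' = 1\<^sub>m n" "B' * C = 1\<^sub>m n" "B' \<in> carrier_mat n n" by auto
  have "B' = B' * (C * B)" using B' CB by simp
  also have "\<dots> = (B' * C) * B" using assoc_mult_mat[OF B'(3) C B] by simp
  also have "\<dots> = B" using B' B by simp
  finally show ?thesis using Some by simp
qed

lemma scalar_prod_spiked_covariance:
  assumes "w \<in> carrier_vec (dim_vec x)"
  shows "w \<bullet> (spiked_covariance a x *\<^sub>v w) = w \<bullet> w - a * (x \<bullet> w)\<^sup>2"
proof -
  let ?m = "dim_vec x"
  have w: "dim_vec w = ?m" using assms by auto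
  have "w \<bullet> (spiked_covariance a x *\<^sub>v w) = (\<Sum>i\<in>{0..<?m}. w $ i * (\<Sum>j\<in>{0..<?m}.
      ((if i = j then 1 else 0) - a * (x $ i * x $ j)) * w $ j))"
    using w by (auto simp: spiked_covariance_def scalar_prod_def intro!: sum.cong)
  also have "\<dots> = (\<Sum>i\<in>{0..<?m}. w $ i * (w $ i - a * x $ i * (x \<bullet> w)))"
  proof (intro sum.cong refl)
    fix i assume i: "i \<in> {0..<?m}"
    have "(\<Sum>j\<in>{0..<?m}. ((if i = j then 1 else 0) - a * (x $ i * x $ j)) * w $ j)
      = (\<Sum>j\<in>{0..<?m}. (if i = j then w $ j else 0)) - (\<Sum>j\<in>{0..<?m}. a * x $ i * (x $ j * w $ j))"
      unfolding sum_subtractf[symmetric] by (intro sum.cong refl) (auto simp: algebra_simps)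
    also have "\<dots> = w $ i - a * x $ i * (x \<bullet> w)"
      using i w by (simp add: scalar_prod_def sum_distrib_left)
    finally show "w $ i * (\<Sum>j\<in>{0..<?m}. ((if i = j then 1 else 0) - a * (x $ i * x $ j)) * w $ j)
       = w $ i * (w $ i - a * x $ i * (x \<bullet> w))" by simp
  qed
  also have "\<dots> = (\<Sum>i\<in>{0..<?m}. w $ i * w $ i) - a * (x \<bullet> w) * (\<Sum>i\<in>{0..<?m}. x $ i * w $ i)"
    unfolding sum_distrib_left sum_subtractf[symmetric] by (intro sum.cong refl) (auto simp: algebra_simps)
  also have "\<dots> = w \<bullet> w - a * (x \<bullet> w)\<^sup>2"
    using w by (simp add: scalar_prod_def power2_eq_square)
  finally show ?thesis .
qed

text \<open>The factor depending on the spike is split off from the standard Gaussian factor, so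
  that the latter cancels in likelihood ratios. The case \<theta> = 0 gives the null
  density.\<close>

lemma gaussian_density_spiked_covariance:
  assumes x: "x \<in> carrier_vec m" "x \<bullet> x = 1" and "\<theta> < 1"
  shows "gaussian_density (spiked_covariance \<theta> x) z =
    exp (- (\<Sum>i<m. (z i)\<^sup>2) / 2) * exp (- (\<theta> / (1 - \<theta>) * (\<Sum>i<m. x $ i * z i)\<^sup>2) / 2)
      / sqrt ((2 * pi) ^ m * (1 - \<theta>))"
proof -
  let ?b = "- \<theta> / (1 - \<theta>)"
  let ?w = "Matrix.vec m z"
  have m: "dim_vec x = m" using x by auto
  \<comment> \<open>\<open>?b\<close> solves a + b - ab = 0 for a = \<theta>, so both products of
    the two spiked matrices are the identity.\<close>
  have b: "\<theta> + ?b - \<theta> * ?b = 0" "?b + \<theta> - ?b * \<theta> = 0"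
    using \<open>\<theta> < 1\<close> by (auto simp: field_simps)
  have "the (mat_inverse (spiked_covariance \<theta> x)) = spiked_covariance ?b x"
    using spiked_covariance_mult[OF x(2), of \<theta> ?b] spiked_covariance_mult[OF x(2), of ?b \<theta>]
      spiked_covariance_carrier[of _ x]
    unfolding b spiked_covariance_0 by (intro the_mat_inverse_eq[of _ "dim_vec x"])
  moreover have "?w \<bullet> (spiked_covariance ?b x *\<^sub>v ?w) = ?w \<bullet> ?w - ?b * (x \<bullet> ?w)\<^sup>2"
    by (rule scalar_prod_spiked_covariance) (use m in auto)
  moreover have "?w \<bullet> ?w = (\<Sum>i<m. (z i)\<^sup>2)" "x \<bullet> ?w = (\<Sum>i<m. x $ i * z i)"
    by (auto simp: scalar_prod_def power2_eq_square lessThan_atLeast0)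
  moreover have "dim_row (spiked_covariance \<theta> x) = m"
    using m by (auto simp: spiked_covariance_def)
  ultimately have "gaussian_density (spiked_covariance \<theta> x) z =
     exp (- ((\<Sum>i<m. (z i)\<^sup>2) - ?b * (\<Sum>i<m. x $ i * z i)\<^sup>2) / 2)
      / sqrt ((2 * pi) ^ m * (1 - \<theta>))"
    unfolding gaussian_density_def Let_def det_spiked_covariance x(2) by simp
  also have "exp (- ((\<Sum>i<m. (z i)\<^sup>2) - ?b * (\<Sum>i<m. x $ i * z i)\<^sup>2) / 2)
    = exp (- (\<Sum>i<m. (z i)\<^sup>2) / 2) * exp (- (\<theta> / (1 - \<theta>) * (\<Sum>i<m. x $ i * z i)\<^sup>2) / 2)"
    unfolding exp_add[symmetric] minus_divide_left[symmetric]
    by (rule arg_cong[where f = exp]) (simp only: mult_minus_left minus_diff_eq add_divide_distrib minus_add_distrib diff_minus_eq_add)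
  finally show ?thesis .
qed

subsection \<open>Gaussian integrals\<close>

text \<open>Completing the square: times the standard normal density, the integrand is a constant
  multiple of the normal density with mean -c / (1 + b) and variance 1 / (1 + b).\<close>

lemma integral_std_normal_exp_quadratic:
  assumes b: "b > -1"
  shows "(\<integral>h. exp (- (b * h\<^sup>2) / 2 - c * h) \<partial>std_normal_distribution)
     = exp (c\<^sup>2 / (2 * (1 + b))) / sqrt (1 + b)"
proof -
  define s where "s = 1 / sqrt (1 + b)"
  have s: "s > 0" "s\<^sup>2 = 1 / (1 + b)" using b by (auto simp: s_def power_divide)
  let ?K = "exp (c\<^sup>2 / (2 * (1 + b))) / sqrt (1 + b)"
  have "std_normal_density h * exp (- (b * h\<^sup>2) / 2 - c * h) = ?K * normal_density (- c / (1 + b)) s h" for h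
  proof -
    have "- h\<^sup>2 / 2 + (- (b * h\<^sup>2) / 2 - c * h) = c\<^sup>2 / (2 * (1 + b)) + - (h - - c / (1 + b))\<^sup>2 / (2 * s\<^sup>2)"
      using b unfolding s(2) by (simp add: divide_simps) (simp add: algebra_simps power2_eq_square)
    then have "exp (- h\<^sup>2 / 2) * exp (- (b * h\<^sup>2) / 2 - c * h)
        = exp (c\<^sup>2 / (2 * (1 + b))) * exp (- (h - - c / (1 + b))\<^sup>2 / (2 * s\<^sup>2))"
      by (simp only: exp_add[symmetric])
    moreover have "sqrt (2 * pi * s\<^sup>2) = sqrt (2 * pi) / sqrt (1 + b)"
      unfolding s(2) by (simp add: real_sqrt_divide)
    ultimately show ?thesis
      using b unfolding std_normal_density_def normal_density_def by simp
  qed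
  then have "(\<integral>h. exp (- (b * h\<^sup>2) / 2 - c * h) \<partial>std_normal_distribution)
     = (\<integral>h. ?K * normal_density (- c / (1 + b)) s h \<partial>lborel)"
    by (subst integral_density) auto
  also have "\<dots> = ?K" using s by simp
  finally show ?thesis .
qed

lemma integral_std_normal_iexp:
  "(\<integral>x. iexp (w * x) \<partial>std_normal_distribution) = complex_of_real (exp (- (w\<^sup>2) / 2))"
  using fun_cong[OF char_std_normal_distribution, of w] by (simp add: char_def)

text \<open>The null distribution, with its density written as a product over coordinates so that
  Fubini for finite products applies directly.\<close>

definition std_gaussian :: "nat \<Rightarrow> (nat \<Rightarrow> real) measure" where
  "std_gaussian m = density (lebesgue_space m) (\<lambda>z. \<Prod>i<m. std_normal_density (z i))"

lemma sets_lebesgue_space [measurable_cong]: "sets (lebesgue_space m) = sets (Pi\<^sub>M {..<m} (\<lambda>_. borel))"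
  unfolding lebesgue_space_def by (rule sets_PiM_cong) auto

lemma sets_std_gaussian [measurable_cong]: "sets (std_gaussian m) = sets (Pi\<^sub>M {..<m} (\<lambda>_. borel))"
  by (simp add: std_gaussian_def sets_lebesgue_space)

text \<open>The Gaussian weight is absorbed coordinate by coordinate, after which the integral over
  the product measure factors. Values in a general normed field allow complex exponentials.\<close>

lemma integral_std_gaussian_prod:
  fixes f :: "nat \<Rightarrow> real \<Rightarrow> 'b :: {real_normed_field, banach, second_countable_topology}"
  assumes "\<And>i. i < m \<Longrightarrow> integrable std_normal_distribution (f i)"
  shows "(\<integral>z. (\<Prod>i<m. f i (z i)) \<partial>std_gaussian m) = (\<Prod>i<m. \<integral>x. f i x \<partial>std_normal_distribution)"
proof -
  interpret product_sigma_finite "\<lambda>_::nat. lborel :: real measure" ..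
  have [measurable]: "f i \<in> borel_measurable borel" if "i < m" for i
    using assms[OF that] borel_measurable_integrable by fastforce
  have int: "integrable lborel (\<lambda>x. std_normal_density x *\<^sub>R f i x)" if "i < m" for i
    using assms[OF that] that by (subst (asm) integrable_density) auto
  have "(\<integral>z. (\<Prod>i<m. f i (z i)) \<partial>std_gaussian m) =
     (\<integral>z. (\<Prod>i<m. std_normal_density (z i)) *\<^sub>R (\<Prod>i<m. f i (z i)) \<partial>lebesgue_space m)"
    unfolding std_gaussian_def
    by (rule integral_density) (auto intro!: prod_nonneg)
  also have "\<dots> = (\<integral>z. (\<Prod>i<m. std_normal_density (z i) *\<^sub>R f i (z i)) \<partial>Pi\<^sub>M {..<m} (\<lambda>_. lborel))"
    unfolding lebesgue_space_def by (simp add: scaleR_conv_of_real prod.distrib)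
  also have "\<dots> = (\<Prod>i<m. \<integral>x. std_normal_density x *\<^sub>R f i x \<partial>lborel)"
    by (rule product_integral_prod) (use int in auto)
  also have "\<dots> = (\<Prod>i<m. \<integral>x. f i x \<partial>std_normal_distribution)"
    by (intro prod.cong refl, subst integral_density) auto
  finally show ?thesis .
qed

lemma prob_space_std_gaussian: "prob_space (std_gaussian m)"
proof
  interpret product_sigma_finite "\<lambda>_::nat. lborel :: real measure" ..
  have "emeasure (std_gaussian m) (space (std_gaussian m))
     = (\<integral>\<^sup>+z. (\<Prod>i<m. ennreal (std_normal_density (z i))) \<partial>Pi\<^sub>M {..<m} (\<lambda>_. lborel))"
    unfolding std_gaussian_def lebesgue_space_def
    by (subst emeasure_density) (auto simp: prod_ennreal space_density intro!: nn_integral_cong)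
  also have "\<dots> = (\<Prod>i<m. \<integral>\<^sup>+x. std_normal_density x \<partial>lborel)"
    by (rule product_nn_integral_prod) auto
  also have "\<dots> = 1"
    by (simp add: nn_integral_eq_integral)
  finally show "emeasure (std_gaussian m) (space (std_gaussian m)) = 1" .
qed

lemma integral_std_gaussian_iexp:
  "(\<integral>z. iexp (\<Sum>i<m. w i * z i) \<partial>std_gaussian m) = complex_of_real (exp (- (\<Sum>i<m. (w i)\<^sup>2) / 2))"
proof -
  interpret real_distribution std_normal_distribution
    by (rule real_dist_normal_dist)
  have "(\<integral>z. iexp (\<Sum>i<m. w i * z i) \<partial>std_gaussian m) = (\<integral>z. (\<Prod>i<m. iexp (w i * z i)) \<partial>std_gaussian m)"
    by (intro Bochner_Integration.integral_cong) (auto simp: exp_sum sum_distrib_left)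
  also have "\<dots> = (\<Prod>i<m. \<integral>x. iexp (w i * x) \<partial>std_normal_distribution)"
    by (rule integral_std_gaussian_prod) (auto intro!: integrable_const_bound[where B = 1])
  also have "\<dots> = (\<Prod>i<m. complex_of_real (exp (- ((w i)\<^sup>2) / 2)))"
    by (intro prod.cong refl integral_std_normal_iexp)
  also have "\<dots> = complex_of_real (exp (- (\<Sum>i<m. (w i)\<^sup>2) / 2))"
    by (simp add: of_real_prod[symmetric] exp_sum[symmetric] sum_negf sum_divide_distrib)
  finally show ?thesis .
qed

text \<open>Cauchy-Schwarz for unit vectors, from the non-negativity of the sums of squares of u + v
  and of u - v.\<close>

lemma abs_sum_mult_unit_le:
  fixes u v :: "'a \<Rightarrow> real"
  assumes "(\<Sum>i\<in>I. (u i)\<^sup>2) = 1" and "(\<Sum>i\<in>I. (v i)\<^sup>2) = 1"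
  shows "\<bar>\<Sum>i\<in>I. u i * v i\<bar> \<le> 1"
proof -
  have "0 \<le> (\<Sum>i\<in>I. (u i + v i)\<^sup>2)" "0 \<le> (\<Sum>i\<in>I. (u i - v i)\<^sup>2)" by (auto intro: sum_nonneg)
  moreover have "(\<Sum>i\<in>I. (u i + v i)\<^sup>2) = 2 + 2 * (\<Sum>i\<in>I. u i * v i)"
      "(\<Sum>i\<in>I. (u i - v i)\<^sup>2) = 2 - 2 * (\<Sum>i\<in>I. u i * v i)"
    using assms by (simp_all add: power2_sum power2_diff sum.distrib sum_subtractf sum_distrib_left mult.assoc)
  ultimately show ?thesis by linarith
qed

text \<open>The Hubbard-Stratonovich step: writing each factor as a characteristic function turns the
  integral over the \<open>m\<close>-dimensional variable into a two-dimensional one.\<close>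

lemma integral_std_gaussian_two_directions:
  fixes u v :: "nat \<Rightarrow> real"
  assumes u: "(\<Sum>i<m. (u i)\<^sup>2) = 1" and v: "(\<Sum>i<m. (v i)\<^sup>2) = 1" and \<beta>: "\<beta> > 0"
  defines "\<rho> \<equiv> (\<Sum>i<m. u i * v i)"
  shows "(\<integral>z. exp (- (\<beta> * (\<Sum>i<m. u i * z i)\<^sup>2) / 2) * exp (- (\<beta> * (\<Sum>i<m. v i * z i)\<^sup>2) / 2) \<partial>std_gaussian m)
    = 1 / sqrt ((1 + \<beta>)\<^sup>2 - \<beta>\<^sup>2 * \<rho>\<^sup>2)"
proof -
  let ?N = "std_normal_distribution"
  let ?P = "?N \<Otimes>\<^sub>M ?N"
  interpret N: real_distribution ?N by (rule real_dist_normal_dist)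
  interpret G: prob_space "std_gaussian m" by (rule prob_space_std_gaussian)
  interpret NN: pair_prob_space ?N ?N ..
  interpret GP: pair_prob_space "std_gaussian m" ?P ..
  define s where "s = (\<lambda>z. \<Sum>i<m. u i * z i)"
  define t where "t = (\<lambda>z. \<Sum>i<m. v i * z i)"
  have [measurable]: "s \<in> borel_measurable (Pi\<^sub>M {..<m} (\<lambda>_. borel))" "t \<in> borel_measurable (Pi\<^sub>M {..<m} (\<lambda>_. borel))"
    unfolding s_def t_def by measurable
  \<comment> \<open>With this scaling, exp (-\<beta> s^2 / 2) is the characteristic function of a
    standard normal at r s; the two factors use independent normals, the components of
    \<open>p\<close>.\<close>
  define r where "r = sqrt \<beta>"
  have r: "r\<^sup>2 = \<beta>" using \<beta> by (simp add: r_def)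
  let ?F = "\<lambda>z p. iexp (r * s z * fst p) * iexp (r * t z * snd p)"
  have sq: "exp (- (\<beta> * x\<^sup>2) / 2) = exp (- ((r * x)\<^sup>2) / 2)" for x
    by (simp add: power_mult_distrib r)
  have prod: "(\<integral>p. f (fst p) * g (snd p) \<partial>?P) = (\<integral>x. f x \<partial>?N) * (\<integral>x. g x \<partial>?N)"
    if [measurable]: "f \<in> borel_measurable borel" "g \<in> borel_measurable borel"
      and b: "\<And>x. norm (f x) \<le> 1" "\<And>x. norm (g x) \<le> 1" for f g :: "real \<Rightarrow> complex"
  proof -
    have "integrable ?P (\<lambda>p. f (fst p) * g (snd p))"
      by (rule NN.P.integrable_const_bound[where B = 1])
        (auto simp: norm_mult intro!: mult_le_one b)
    from NN.integral_fst'[OF this] show ?thesis by simp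
  qed
  have "complex_of_real (\<integral>z. exp (- (\<beta> * (s z)\<^sup>2) / 2) * exp (- (\<beta> * (t z)\<^sup>2) / 2) \<partial>std_gaussian m)
     = (\<integral>z. complex_of_real (exp (- ((r * s z)\<^sup>2) / 2)) * complex_of_real (exp (- ((r * t z)\<^sup>2) / 2)) \<partial>std_gaussian m)"
    unfolding sq of_real_mult[symmetric] by (rule integral_complex_of_real[symmetric])
  also have "\<dots> = (\<integral>z. (\<integral>p. ?F z p \<partial>?P) \<partial>std_gaussian m)"
  proof (rule Bochner_Integration.integral_cong[OF refl])
    fix z
    show "complex_of_real (exp (- ((r * s z)\<^sup>2) / 2)) * complex_of_real (exp (- ((r * t z)\<^sup>2) / 2))
      = (\<integral>p. ?F z p \<partial>?P)"
      unfolding integral_std_normal_iexp[symmetric]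
      by (rule prod[symmetric]) auto
  qed
  \<comment> \<open>The integrand has modulus 1 and all measures are probability measures, so the
    order of integration may be exchanged.\<close>
  also have "\<dots> = (\<integral>p. (\<integral>z. ?F z p \<partial>std_gaussian m) \<partial>?P)"
  proof (rule GP.Fubini_integral[symmetric])
    show "integrable (std_gaussian m \<Otimes>\<^sub>M ?P) (\<lambda>(z, p). ?F z p)"
      by (rule GP.P.integrable_const_bound[where B = 1])
        (auto simp: norm_mult case_prod_beta)
  qed
  also have "\<dots> = (\<integral>p. complex_of_real (exp (- (\<beta> * (fst p)\<^sup>2) / 2) * exp (- (\<beta> * (snd p)\<^sup>2) / 2 - \<beta> * \<rho> * fst p * snd p)) \<partial>?P)"
  proof (rule Bochner_Integration.integral_cong[OF refl])
    fix p :: "real \<times> real"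
    obtain g h where p: "p = (g, h)" by force
    \<comment> \<open>For fixed (g, h) the inner integral is the characteristic function of the
      standard Gaussian at this frequency vector, whose squared norm is \<beta> (g^2 + h^2 + 2 g h
      \<rho>).\<close>
    let ?w = "\<lambda>i. r * (g * u i + h * v i)"
    have lin: "(\<Sum>i<m. ?w i * z i) = r * s z * g + r * t z * h" for z
      by (simp add: s_def t_def algebra_simps sum.distrib sum_distrib_left)
    have "(\<integral>z. ?F z p \<partial>std_gaussian m) = (\<integral>z. iexp (\<Sum>i<m. ?w i * z i) \<partial>std_gaussian m)"
      unfolding lin p by (simp add: exp_add[symmetric] algebra_simps)
    also have "\<dots> = complex_of_real (exp (- (\<Sum>i<m. (?w i)\<^sup>2) / 2))"
      by (rule integral_std_gaussian_iexp)
    also have "(\<Sum>i<m. (?w i)\<^sup>2) = \<beta> * (g\<^sup>2 * (\<Sum>i<m. (u i)\<^sup>2) + h\<^sup>2 * (\<Sum>i<m. (v i)\<^sup>2) + 2 * g * h * \<rho>)"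
      unfolding \<rho>_def sum_distrib_left sum.distrib[symmetric] r[symmetric]
      by (intro sum.cong refl) (simp add: power2_eq_square algebra_simps)
    also have "exp (- \<dots> / 2) = exp (- (\<beta> * g\<^sup>2) / 2) * exp (- (\<beta> * h\<^sup>2) / 2 - \<beta> * \<rho> * g * h)"
      unfolding u v exp_add[symmetric] by (simp add: field_simps)
    finally show "(\<integral>z. ?F z p \<partial>std_gaussian m) = complex_of_real (exp (- (\<beta> * (fst p)\<^sup>2) / 2) * exp (- (\<beta> * (snd p)\<^sup>2) / 2 - \<beta> * \<rho> * fst p * snd p))"
      by (simp add: p)
  qed
  also have "\<dots> = complex_of_real (\<integral>p. exp (- (\<beta> * (fst p)\<^sup>2) / 2) * exp (- (\<beta> * (snd p)\<^sup>2) / 2 - \<beta> * \<rho> * fst p * snd p) \<partial>?P)"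
    by (rule integral_complex_of_real)
  also have "(\<integral>p. exp (- (\<beta> * (fst p)\<^sup>2) / 2) * exp (- (\<beta> * (snd p)\<^sup>2) / 2 - \<beta> * \<rho> * fst p * snd p) \<partial>?P)
     = (\<integral>g. \<integral>h. exp (- (\<beta> * g\<^sup>2) / 2) * exp (- (\<beta> * h\<^sup>2) / 2 - \<beta> * \<rho> * g * h) \<partial>?N \<partial>?N)"
  proof -
    have rho: "\<bar>\<rho>\<bar> \<le> 1"
      using abs_sum_mult_unit_le[OF u v] by (simp add: \<rho>_def)
    \<comment> \<open>Integrability for Fubini: g^2 + h^2 + 2 \<rho> g h is non-negative because
      |\<rho>| \<le> 1.\<close>
    have bd: "exp (- (\<beta> * g\<^sup>2) / 2) * exp (- (\<beta> * h\<^sup>2) / 2 - \<beta> * \<rho> * g * h) \<le> 1" for g h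
    proof -
      have "\<bar>\<rho> * g * h\<bar> \<le> 1 * \<bar>g * h\<bar>"
        unfolding abs_mult mult.assoc by (rule mult_right_mono) (use rho in auto)
      moreover have "2 * \<bar>g * h\<bar> \<le> g\<^sup>2 + h\<^sup>2"
        using sum_squares_bound[of "\<bar>g\<bar>" "\<bar>h\<bar>"] by (simp add: abs_mult)
      ultimately have "0 \<le> g\<^sup>2 / 2 + h\<^sup>2 / 2 + \<rho> * g * h" by linarith
      then have "0 \<le> \<beta> * (g\<^sup>2 / 2 + h\<^sup>2 / 2 + \<rho> * g * h)" using \<beta> by simp
      then show ?thesis unfolding exp_add[symmetric] by (simp add: algebra_simps)
    qed
    have "integrable ?P (\<lambda>p. exp (- (\<beta> * (fst p)\<^sup>2) / 2) * exp (- (\<beta> * (snd p)\<^sup>2) / 2 - \<beta> * \<rho> * fst p * snd p))"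
      by (rule NN.P.integrable_const_bound[where B = 1]) (use bd in auto)
    from NN.integral_fst'[OF this] show ?thesis by simp
  qed
  \<comment> \<open>Integrating out h leaves a Gaussian integral in g with a reduced quadratic
    coefficient. The vacuous term \<open>0 * g\<close> keeps the shape of the one-dimensional
    formula, which is used once more.\<close>
  also have "\<dots> = (\<integral>g. exp (- ((\<beta> - (\<beta> * \<rho>)\<^sup>2 / (1 + \<beta>)) * g\<^sup>2) / 2 - 0 * g) / sqrt (1 + \<beta>) \<partial>?N)"
  proof (rule Bochner_Integration.integral_cong[OF refl])
    fix g
    have "(\<integral>h. exp (- (\<beta> * g\<^sup>2) / 2) * exp (- (\<beta> * h\<^sup>2) / 2 - \<beta> * \<rho> * g * h) \<partial>?N)
      = exp (- (\<beta> * g\<^sup>2) / 2) * exp ((\<beta> * \<rho> * g)\<^sup>2 / (2 * (1 + \<beta>))) / sqrt (1 + \<beta>)"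
      using integral_std_normal_exp_quadratic[of \<beta> "\<beta> * \<rho> * g"] \<beta> by simp
    also have "exp (- (\<beta> * g\<^sup>2) / 2) * exp ((\<beta> * \<rho> * g)\<^sup>2 / (2 * (1 + \<beta>)))
       = exp (- ((\<beta> - (\<beta> * \<rho>)\<^sup>2 / (1 + \<beta>)) * g\<^sup>2) / 2 - 0 * g)"
      using \<beta> unfolding exp_add[symmetric] by (simp add: field_simps)
    finally show "(\<integral>h. exp (- (\<beta> * g\<^sup>2) / 2) * exp (- (\<beta> * h\<^sup>2) / 2 - \<beta> * \<rho> * g * h) \<partial>?N)
      = exp (- ((\<beta> - (\<beta> * \<rho>)\<^sup>2 / (1 + \<beta>)) * g\<^sup>2) / 2 - 0 * g) / sqrt (1 + \<beta>)" by simp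
  qed
  also have "\<dots> = 1 / sqrt (1 + (\<beta> - (\<beta> * \<rho>)\<^sup>2 / (1 + \<beta>))) / sqrt (1 + \<beta>)"
  proof -
    have "\<rho>\<^sup>2 \<le> 1"
      using abs_sum_mult_unit_le[OF u v] by (simp add: \<rho>_def abs_square_le_1)
    then have "(\<beta> * \<rho>)\<^sup>2 \<le> \<beta>\<^sup>2 * 1" unfolding power_mult_distrib by (intro mult_left_mono) auto
    also have "\<beta>\<^sup>2 \<le> \<beta> * (1 + \<beta>)" using \<beta> by (simp add: power2_eq_square algebra_simps)
    finally have "(\<beta> * \<rho>)\<^sup>2 / (1 + \<beta>) \<le> \<beta>" using \<beta> by (simp add: field_simps)
    then show ?thesis
      using integral_std_normal_exp_quadratic[of "\<beta> - (\<beta> * \<rho>)\<^sup>2 / (1 + \<beta>)" 0] by simp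
  qed
  also have "\<dots> = 1 / sqrt ((1 + \<beta>)\<^sup>2 - \<beta>\<^sup>2 * \<rho>\<^sup>2)"
  proof -
    have "(1 + (\<beta> - (\<beta> * \<rho>)\<^sup>2 / (1 + \<beta>))) * (1 + \<beta>) = (1 + \<beta>)\<^sup>2 - \<beta>\<^sup>2 * \<rho>\<^sup>2"
      using \<beta> by (simp add: field_simps power2_eq_square)
    then show ?thesis by (simp add: real_sqrt_mult[symmetric])
  qed
  finally show ?thesis
    unfolding s_def t_def of_real_eq_iff .
qed

subsection \<open>Exponential moments of the overlap of sparse sign vectors\<close>

text \<open>Up to the factor \<open>d choose k\<close> this bounds the generating function of a
  hypergeometric variable by that of a Poisson variable with mean k^2 / d. The power of c is
  expanded into powers of c - 1 over the subsets J of the intersection, the sums are swapped, and a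
  given J lies in at most a (k / d)^|J| fraction of all k-sets.\<close>

lemma sum_power_card_inter_le:
  fixes c :: real
  assumes k: "k \<le> d" "0 < d" and B: "B \<subseteq> {..<d}" "card B = k" and c: "c \<ge> 1"
  shows "(\<Sum>A | A \<subseteq> {..<d} \<and> card A = k. c ^ card (A \<inter> B))
    \<le> real (d choose k) * exp (real k ^ 2 / real d * (c - 1))"
proof -
  let ?S = "{A. A \<subseteq> {..<d} \<and> card A = k}"
  have finB: "finite B" using B(1) finite_subset by blast
  have finS: "finite ?S" by auto
  have card_supersets: "card {A \<in> ?S. J \<subseteq> A} = (d - card J) choose (k - card J)"
    if J: "J \<subseteq> B" for J
  proof -
    have finJ: "finite J" using J finB finite_subset by blast
    have Jd: "J \<subseteq> {..<d}" using J B by blast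
    have cJ: "card J \<le> k" using J B finB card_mono by metis
    have "bij_betw (\<lambda>A. A - J) {A \<in> ?S. J \<subseteq> A} {K. K \<subseteq> {..<d} - J \<and> card K = k - card J}"
    proof (rule bij_betwI[where g = "\<lambda>K. K \<union> J"])
      show "(\<lambda>A. A - J) \<in> {A \<in> ?S. J \<subseteq> A} \<rightarrow> {K. K \<subseteq> {..<d} - J \<and> card K = k - card J}"
        using finJ by (auto simp: card_Diff_subset)
      show "(\<lambda>K. K \<union> J) \<in> {K. K \<subseteq> {..<d} - J \<and> card K = k - card J} \<rightarrow> {A \<in> ?S. J \<subseteq> A}"
      proof
        fix K assume K: "K \<in> {K. K \<subseteq> {..<d} - J \<and> card K = k - card J}"
        then have "finite K" using finite_subset by blast
        moreover have "K \<inter> J = {}" using K by blast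
        ultimately have "card (K \<union> J) = k" using K finJ cJ by (simp add: card_Un_disjoint)
        then show "K \<union> J \<in> {A \<in> ?S. J \<subseteq> A}" using K Jd by auto
      qed
    qed auto
    then have "card {A \<in> ?S. J \<subseteq> A} = card {K. K \<subseteq> {..<d} - J \<and> card K = k - card J}"
      by (rule bij_betw_same_card)
    also have "\<dots> = card ({..<d} - J) choose (k - card J)"
      by (rule n_subsets) auto
    also have "card ({..<d} - J) = d - card J"
      using Jd finJ by (simp add: card_Diff_subset)
    finally show ?thesis .
  qed
  \<comment> \<open>Passing from j to j + 1 multiplies the binomial coefficient by (k - j) / (d -
    j), which is at most k / d as k \<le> d.\<close>
  have ratio: "real ((d - j) choose (k - j)) \<le> real (d choose k) * (real k / real d) ^ j" if "j \<le> k" for j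
    using that
  proof (induction j)
    case (Suc j)
    have jk: "j < k" "j < d" using Suc.prems k by auto
    have "(d - j) * ((d - Suc j) choose (k - Suc j)) = (k - j) * ((d - j) choose (k - j))"
      using binomial_absorption[of "k - Suc j" "d - j"] jk by (simp add: Suc_diff_Suc)
    then have "real (d - j) * real ((d - Suc j) choose (k - Suc j)) = real (k - j) * real ((d - j) choose (k - j))"
      by (metis of_nat_mult)
    then have "real ((d - Suc j) choose (k - Suc j)) = real (k - j) / real (d - j) * real ((d - j) choose (k - j))"
      using jk by (simp add: field_simps)
    also have "\<dots> \<le> real k / real d * (real (d choose k) * (real k / real d) ^ j)"
    proof (rule mult_mono)
      have "real j * real k \<le> real j * real d" using k by (intro mult_left_mono) auto
      then show "real (k - j) / real (d - j) \<le> real k / real d"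
        using jk k by (simp add: field_simps of_nat_diff)
    qed (use Suc in auto)
    finally show ?case by (simp add: mult_ac)
  qed auto
  have expand: "c ^ card X = (\<Sum>J\<in>Pow X. (c - 1) ^ card J)" if "finite X" for X :: "nat set"
    using prod_add[OF that, of "\<lambda>_. c - 1" "\<lambda>_. 1"] by simp
  have "(\<Sum>A\<in>?S. c ^ card (A \<inter> B)) = (\<Sum>A\<in>?S. \<Sum>J\<in>{J \<in> Pow B. J \<subseteq> A}. (c - 1) ^ card J)"
  proof (rule sum.cong[OF refl])
    fix A
    have "Pow (A \<inter> B) = {J \<in> Pow B. J \<subseteq> A}" by auto
    then show "c ^ card (A \<inter> B) = (\<Sum>J\<in>{J \<in> Pow B. J \<subseteq> A}. (c - 1) ^ card J)"
      using expand[of "A \<inter> B"] finB by simp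
  qed
  also have "\<dots> = (\<Sum>J\<in>Pow B. \<Sum>A\<in>{A \<in> ?S. J \<subseteq> A}. (c - 1) ^ card J)"
    by (rule sum.swap_restrict) (use finS finB in auto)
  also have "\<dots> = (\<Sum>J\<in>Pow B. real ((d - card J) choose (k - card J)) * (c - 1) ^ card J)"
    by (intro sum.cong refl) (use card_supersets in auto)
  also have "\<dots> \<le> (\<Sum>J\<in>Pow B. real (d choose k) * (real k / real d * (c - 1)) ^ card J)"
  proof (rule sum_mono)
    fix J assume "J \<in> Pow B"
    then have "card J \<le> k" using B finB card_mono by blast
    then have "real ((d - card J) choose (k - card J)) * (c - 1) ^ card J
      \<le> (real (d choose k) * (real k / real d) ^ card J) * (c - 1) ^ card J"
      using c by (intro mult_right_mono ratio) auto
    then show "real ((d - card J) choose (k - card J)) * (c - 1) ^ card J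
      \<le> real (d choose k) * (real k / real d * (c - 1)) ^ card J"
      unfolding power_mult_distrib by (simp add: mult_ac)
  qed
  also have "\<dots> = real (d choose k) * (1 + real k / real d * (c - 1)) ^ k"
    using prod_add[OF finB, of "\<lambda>_. real k / real d * (c - 1)" "\<lambda>_. 1"] B
    by (simp add: sum_distrib_left[symmetric] add.commute)
  also have "\<dots> \<le> real (d choose k) * exp (real k / real d * (c - 1)) ^ k"
    using c by (intro mult_left_mono power_mono exp_ge_add_one_self) auto
  also have "exp (real k / real d * (c - 1)) ^ k = exp (real k ^ 2 / real d * (c - 1))"
    by (simp add: exp_of_nat_mult[symmetric] power2_eq_square)
  finally show ?thesis .
qed

definition supp_vec :: "real Matrix.vec \<Rightarrow> nat set" where
  "supp_vec y = {i. i < dim_vec y \<and> y $ i \<noteq> 0}"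

text \<open>Vectors are grouped by support. Over a fixed support A the coordinates vary
  independently, in {s, -s} on A and in {0} off A, so the sum of products factors. Constant factors
  1 give the cardinality, exponentials the moment generating function.\<close>

lemma sum_sparse_sign_vectors:
  fixes f :: "nat \<Rightarrow> real \<Rightarrow> real" and d k :: nat
  defines "s \<equiv> 1 / sqrt (real k + 1)"
  shows "finite (sparse_sign_vectors d k)"
    and "(\<Sum>y\<in>sparse_sign_vectors d k. \<Prod>i<d. f i (y $ i))
    = (\<Sum>A | A \<subseteq> {..<d} \<and> card A = k. \<Prod>i<d. if i \<in> A then f i s + f i (- s) else f i 0)"
proof -
  let ?S = "{A. A \<subseteq> {..<d} \<and> card A = k}"
  let ?V = "\<lambda>A i. if i \<in> A then {s, - s} else {0 :: real}"
  have s: "s > 0" by (simp add: s_def)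
  have s': "- 1 / sqrt (real k + 1) = - s" by (simp add: s_def)
  have bij: "bij_betw (Matrix.vec d) (PiE {..<d} (?V A)) {y \<in> sparse_sign_vectors d k. supp_vec y = A}"
    if A: "A \<in> ?S" for A
  proof (rule bij_betwI[where g = "\<lambda>y. restrict (($) y) {..<d}"])
    show "Matrix.vec d \<in> PiE {..<d} (?V A) \<rightarrow> {y \<in> sparse_sign_vectors d k. supp_vec y = A}"
    proof
      fix g assume g: "g \<in> PiE {..<d} (?V A)"
      have g': "g i \<in> ?V A i" if "i < d" for i
        by (rule PiE_mem[OF g]) (use that in simp)
      have nz: "g i \<noteq> 0 \<longleftrightarrow> i \<in> A" if "i < d" for i
        using g'[OF that] s by (cases "i \<in> A") auto
      then have "{i. i < d \<and> Matrix.vec d g $ i \<noteq> 0} = {i. i < d \<and> i \<in> A}"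
        by (intro Collect_cong conj_cong refl) (simp add: nz)
      also have "\<dots> = A" using A by auto
      finally have supp: "{i. i < d \<and> Matrix.vec d g $ i \<noteq> 0} = A" .
      moreover have "\<forall>i<d. Matrix.vec d g $ i \<in> {s, - s, 0}"
      proof (intro allI impI)
        fix i assume "i < d"
        then show "Matrix.vec d g $ i \<in> {s, - s, 0}"
          using g'[of i] by (cases "i \<in> A") auto
      qed
      ultimately show "Matrix.vec d g \<in> {y \<in> sparse_sign_vectors d k. supp_vec y = A}"
        using A unfolding sparse_sign_vectors_def supp_vec_def s'
        by (auto simp flip: s_def)
    qed
    show "(\<lambda>y. restrict (($) y) {..<d}) \<in> {y \<in> sparse_sign_vectors d k. supp_vec y = A} \<rightarrow> PiE {..<d} (?V A)"
      unfolding sparse_sign_vectors_def supp_vec_def s'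
      by (auto simp flip: s_def)
    show "restrict (($) (Matrix.vec d g)) {..<d} = g" if "g \<in> PiE {..<d} (?V A)" for g
      using that by (auto simp: fun_eq_iff restrict_def PiE_def extensional_def)
    show "Matrix.vec d (restrict (($) y) {..<d}) = y" if "y \<in> {y \<in> sparse_sign_vectors d k. supp_vec y = A}" for y
      using that by (auto simp: sparse_sign_vectors_def)
  qed
  have finA: "finite {y \<in> sparse_sign_vectors d k. supp_vec y = A}" if "A \<in> ?S" for A
    using bij_betw_finite[OF bij[OF that]] by (auto intro!: finite_PiE)
  have maps: "supp_vec y \<in> ?S" if "y \<in> sparse_sign_vectors d k" for y
    using that by (auto simp: sparse_sign_vectors_def supp_vec_def)
  have "sparse_sign_vectors d k = (\<Union>A\<in>?S. {y \<in> sparse_sign_vectors d k. supp_vec y = A})"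
    using maps by blast
  also have "finite \<dots>" using finA by auto
  finally show fin: "finite (sparse_sign_vectors d k)" .
  have "(\<Sum>y\<in>sparse_sign_vectors d k. \<Prod>i<d. f i (y $ i))
     = (\<Sum>A\<in>?S. \<Sum>y\<in>{y \<in> sparse_sign_vectors d k. supp_vec y = A}. \<Prod>i<d. f i (y $ i))"
    by (rule sum.group[symmetric]) (use fin maps in auto)
  also have "\<dots> = (\<Sum>A\<in>?S. \<Prod>i<d. if i \<in> A then f i s + f i (- s) else f i 0)"
  proof (rule sum.cong[OF refl])
    fix A assume A: "A \<in> ?S"
    have "(\<Sum>y\<in>{y \<in> sparse_sign_vectors d k. supp_vec y = A}. \<Prod>i<d. f i (y $ i))
      = (\<Sum>g\<in>PiE {..<d} (?V A). \<Prod>i<d. f i (g i))"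
      by (subst sum.reindex_bij_betw[OF bij[OF A], symmetric]) simp
    also have "\<dots> = (\<Prod>i<d. \<Sum>x\<in>?V A i. f i x)"
      by (rule prod_sum_PiE[symmetric]) auto
    also have "\<dots> = (\<Prod>i<d. if i \<in> A then f i s + f i (- s) else f i 0)"
      using s by (intro prod.cong refl) auto
    finally show "(\<Sum>y\<in>{y \<in> sparse_sign_vectors d k. supp_vec y = A}. \<Prod>i<d. f i (y $ i)) = \<dots>" .
  qed
  finally show "(\<Sum>y\<in>sparse_sign_vectors d k. \<Prod>i<d. f i (y $ i)) = \<dots>" .
qed

lemma card_sparse_sign_vectors: "card (sparse_sign_vectors d k) = (d choose k) * 2 ^ k"
proof -
  let ?S = "{A. A \<subseteq> {..<d} \<and> card A = k}"
  have "real (card (sparse_sign_vectors d k)) = (\<Sum>A\<in>?S. \<Prod>i<d. if i \<in> A then 2 else 1)"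
    using sum_sparse_sign_vectors(2)[of "\<lambda>_ _. 1" d k] by (simp cong: if_cong)
  also have "\<dots> = (\<Sum>A\<in>?S. 2 ^ k)"
  proof (rule sum.cong[OF refl])
    fix A assume A: "A \<in> ?S"
    then have "(\<Prod>i<d. if i \<in> A then 2 else 1 :: real) = 2 ^ card ({..<d} \<inter> A)"
      by (subst prod.inter_restrict[symmetric]) auto
    also have "{..<d} \<inter> A = A" using A by auto
    finally show "(\<Prod>i<d. if i \<in> A then 2 else 1 :: real) = 2 ^ k" using A by simp
  qed
  also have "\<dots> = real ((d choose k) * 2 ^ k)"
    using n_subsets[of "{..<d}" k] by simp
  finally show ?thesis by linarith
qed

text \<open>Summing over signs gives \<open>2 * cosh t\<close> for each coordinate common to both
  supports and 2 for every other coordinate in the support of y. What remains is the generating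
  function of the intersection size at c = cosh t \<ge> 1.\<close>

lemma sum_exp_scalar_prod_sparse_sign_vectors_le:
  assumes k: "k \<le> d" "0 < d" and u: "u \<in> sparse_sign_vectors d k"
  shows "(\<Sum>y\<in>sparse_sign_vectors d k. exp (t * ((real k + 1) * (y \<bullet> u))))
    \<le> real (card (sparse_sign_vectors d k)) * exp (real k ^ 2 / real d * (cosh t - 1))"
proof -
  let ?S = "{A. A \<subseteq> {..<d} \<and> card A = k}"
  let ?s = "1 / sqrt (real k + 1)"
  let ?f = "\<lambda>i x. exp (t * ((real k + 1) * (x * u $ i)))"
  let ?B = "supp_vec u"
  have u': "u \<in> carrier_vec d" "\<And>i. i < d \<Longrightarrow> u $ i \<in> {?s, - ?s, 0}" "card ?B = k" "?B \<subseteq> {..<d}"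
    using u by (auto simp: sparse_sign_vectors_def supp_vec_def)
  \<comment> \<open>After scaling by k + 1, every common support coordinate contributes exactly 1 or
    -1 to the overlap.\<close>
  have ss: "(real k + 1) * (?s * ?s) = 1" by simp
  have "(\<Sum>y\<in>sparse_sign_vectors d k. exp (t * ((real k + 1) * (y \<bullet> u))))
    = (\<Sum>y\<in>sparse_sign_vectors d k. \<Prod>i<d. ?f i (y $ i))"
    using u' by (intro sum.cong refl)
      (simp add: scalar_prod_def lessThan_atLeast0 sum_distrib_left exp_sum)
  also have "\<dots> = (\<Sum>A\<in>?S. \<Prod>i<d. if i \<in> A then ?f i ?s + ?f i (- ?s) else ?f i 0)"
    by (rule sum_sparse_sign_vectors(2))
  also have "\<dots> = (\<Sum>A\<in>?S. 2 ^ k * cosh t ^ card (A \<inter> ?B))"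
  proof (rule sum.cong[OF refl])
    fix A assume A: "A \<in> ?S"
    have "(\<Prod>i<d. if i \<in> A then ?f i ?s + ?f i (- ?s) else ?f i 0)
      = (\<Prod>i<d. if i \<in> A then ?f i ?s + ?f i (- ?s) else 1)" by (intro prod.cong) auto
    also have "\<dots> = (\<Prod>i\<in>{..<d} \<inter> A. ?f i ?s + ?f i (- ?s))"
      by (rule prod.inter_restrict[symmetric]) simp
    also have "{..<d} \<inter> A = A" using A by auto
    also have "(\<Prod>i\<in>A. ?f i ?s + ?f i (- ?s)) = (\<Prod>i\<in>A. 2 * (if i \<in> ?B then cosh t else 1))"
    proof (rule prod.cong[OF refl])
      fix i assume "i \<in> A"
      then have i: "i < d" using A by auto
      have B: "i \<in> ?B \<longleftrightarrow> u $ i \<noteq> 0" using i u' by (auto simp: supp_vec_def)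
      have f: "?f i x = exp (t * ((real k + 1) * (x * u $ i)))" for x by simp
      consider "u $ i = 0" | "u $ i = ?s" | "u $ i = - ?s" using u'(2)[OF i] by blast
      then show "?f i ?s + ?f i (- ?s) = 2 * (if i \<in> ?B then cosh t else 1)"
      proof cases
        case 1 then show ?thesis using B by simp
      next
        case 2
        then have "(real k + 1) * (?s * u $ i) = 1" "(real k + 1) * (- ?s * u $ i) = - 1" using ss by auto
        then show ?thesis using 2 B unfolding cosh_def by simp
      next
        case 3
        then have "(real k + 1) * (?s * u $ i) = - 1" "(real k + 1) * (- ?s * u $ i) = 1" using ss by auto
        then show ?thesis using 3 B unfolding cosh_def by simp
      qed
    qed
    also have "\<dots> = 2 ^ card A * (\<Prod>i\<in>A. if i \<in> ?B then cosh t else 1)"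
      by (simp add: prod.distrib)
    also have "(\<Prod>i\<in>A. if i \<in> ?B then cosh t else 1) = cosh t ^ card (A \<inter> ?B)"
      using A finite_subset by (subst prod.inter_restrict[symmetric]) auto
    finally show "(\<Prod>i<d. if i \<in> A then ?f i ?s + ?f i (- ?s) else ?f i 0) = 2 ^ k * cosh t ^ card (A \<inter> ?B)"
      using A by simp
  qed
  also have "\<dots> \<le> 2 ^ k * (real (d choose k) * exp (real k ^ 2 / real d * (cosh t - 1)))"
    unfolding sum_distrib_left[symmetric]
    by (intro mult_left_mono sum_power_card_inter_le) (use k u' cosh_real_ge_1 in auto)
  finally show ?thesis
    by (simp add: card_sparse_sign_vectors mult_ac)
qed

subsection \<open>Conditioning and statistical dimension\<close>

text \<open>Each likelihood ratio is exp (-\<beta> s^2 / 2) / sqrt (1 - \<theta>) with s the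
  projection on the spike, so the two-direction integral applies; 1 + \<beta> = 1 / (1 - \<theta>)
  simplifies its value.\<close>

lemma likelihood_corr_spiked:
  assumes u: "u \<in> carrier_vec m" "u \<bullet> u = 1" and v: "v \<in> carrier_vec m" "v \<bullet> v = 1"
    and \<theta>: "0 < \<theta>" "\<theta> < 1"
  shows "likelihood_corr (lebesgue_space m) (gaussian_density (1\<^sub>m m))
     (\<lambda>x. gaussian_density (spiked_covariance \<theta> x)) u v = 1 / sqrt (1 - \<theta>\<^sup>2 * (u \<bullet> v)\<^sup>2)"
proof -
  define \<beta> where "\<beta> = \<theta> / (1 - \<theta>)"
  have \<beta>: "\<beta> > 0" using \<theta> by (simp add: \<beta>_def)
  have dot: "x \<bullet> y = (\<Sum>i<m. x $ i * y $ i)" if "y \<in> carrier_vec m" for x y :: "real Matrix.vec"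
    using that by (simp add: scalar_prod_def lessThan_atLeast0)
  \<comment> \<open>The null density is the spiked one at \<theta> = 0, with u serving as an
    arbitrary unit vector.\<close>
  have null: "gaussian_density (1\<^sub>m m) z = exp (- (\<Sum>i<m. (z i)\<^sup>2) / 2) / sqrt ((2 * pi) ^ m)" for z
    using gaussian_density_spiked_covariance[OF u, of 0 z] u by (auto simp: spiked_covariance_0)
  have null_prod: "gaussian_density (1\<^sub>m m) z = (\<Prod>i<m. std_normal_density (z i))" for z
    unfolding null real_sqrt_power std_normal_density_def
    by (simp add: prod.distrib exp_sum[symmetric] sum_negf sum_divide_distrib prod_dividef power_one_over)
  have null_pos: "gaussian_density (1\<^sub>m m) z > 0" for z
    unfolding null by simp
  have ratio: "gaussian_density (spiked_covariance \<theta> x) z / gaussian_density (1\<^sub>m m) z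
     = exp (- (\<beta> * (\<Sum>i<m. x $ i * z i)\<^sup>2) / 2) / sqrt (1 - \<theta>)"
    if "x \<in> carrier_vec m" "x \<bullet> x = 1" for x z
    using \<theta> unfolding gaussian_density_spiked_covariance[OF that \<theta>(2)] null \<beta>_def
    by (simp add: real_sqrt_mult)
  have "likelihood_corr (lebesgue_space m) (gaussian_density (1\<^sub>m m))
     (\<lambda>x. gaussian_density (spiked_covariance \<theta> x)) u v
    = (\<integral>z. exp (- (\<beta> * (\<Sum>i<m. u $ i * z i)\<^sup>2) / 2) * exp (- (\<beta> * (\<Sum>i<m. v $ i * z i)\<^sup>2) / 2) / (1 - \<theta>) \<partial>std_gaussian m)"
    unfolding likelihood_corr_def ratio[OF u] ratio[OF v] std_gaussian_def null_prod[symmetric]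
    using \<theta> by (simp add: abs_of_nonneg)
  also have "\<dots> = 1 / sqrt ((1 + \<beta>)\<^sup>2 - \<beta>\<^sup>2 * (u \<bullet> v)\<^sup>2) / (1 - \<theta>)"
    using integral_std_gaussian_two_directions[where m = m and u = "($) u" and v = "($) v" and \<beta> = \<beta>] u v \<beta>
    by (simp add: dot power2_eq_square)
  also have "\<dots> = 1 / (sqrt ((1 + \<beta>)\<^sup>2 - \<beta>\<^sup>2 * (u \<bullet> v)\<^sup>2) * sqrt ((1 - \<theta>)\<^sup>2))"
    using \<theta> by simp
  also have "sqrt ((1 + \<beta>)\<^sup>2 - \<beta>\<^sup>2 * (u \<bullet> v)\<^sup>2) * sqrt ((1 - \<theta>)\<^sup>2)
     = sqrt (((1 + \<beta>) * (1 - \<theta>))\<^sup>2 - (\<beta> * (1 - \<theta>))\<^sup>2 * (u \<bullet> v)\<^sup>2)"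
    unfolding real_sqrt_mult[symmetric] by (simp add: power_mult_distrib left_diff_distrib)
  also have "(1 + \<beta>) * (1 - \<theta>) = 1"
    using \<theta> by (simp add: \<beta>_def field_simps)
  also have "\<beta> * (1 - \<theta>) = \<theta>"
    using \<theta> by (simp add: \<beta>_def)
  finally show ?thesis by simp
qed

text \<open>For non-negative f, dropping the indicator of E in the numerator only increases the
  conditional expectation.\<close>

lemma expectation_cond_pmf_le:
  fixes f :: "'a \<Rightarrow> real"
  assumes fin: "finite (set_pmf p)" and E: "measure_pmf.prob p E > 0"
    and f: "\<And>x. f x \<ge> 0"
  shows "measure_pmf.expectation (cond_pmf p E) f \<le> measure_pmf.expectation p f / measure_pmf.prob p E"
proof -
  have ne: "set_pmf p \<inter> E \<noteq> {}"
    using E measure_pmf_zero_iff[of p E] by auto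
  have "measure_pmf.expectation (cond_pmf p E) f = (\<Sum>x\<in>set_pmf p. f x * pmf (cond_pmf p E) x)"
    by (rule integral_measure_pmf_real) (use fin ne in auto)
  also have "\<dots> \<le> (\<Sum>x\<in>set_pmf p. f x * pmf p x / measure_pmf.prob p E)"
    using E f by (intro sum_mono) (auto simp: pmf_cond[OF ne])
  also have "\<dots> = measure_pmf.expectation p f / measure_pmf.prob p E"
    by (subst integral_measure_pmf_real[OF fin]) (auto simp: sum_divide_distrib)
  finally show ?thesis .
qed

text \<open>Entropy-type bound: conditioning on an event of probability \<open>r\<close> can raise the second moment
  only to about the square of \<open>ln (M / r)\<close>, where \<open>M\<close> is the exponential moment.\<close>

lemma expectation_cond_pmf_square_le:
  fixes X :: "'a \<Rightarrow> real"
  assumes fin: "finite (set_pmf p)" and E: "measure_pmf.prob p E > 0"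
    and X: "\<And>x. X x \<ge> 0" and a: "a \<ge> 0"
    and M: "measure_pmf.expectation p (\<lambda>x. exp (X x)) \<le> exp a * measure_pmf.prob p E"
  shows "measure_pmf.expectation (cond_pmf p E) (\<lambda>x. (X x)\<^sup>2) \<le> 2 * a\<^sup>2 + 4"
proof -
  have ne: "set_pmf p \<inter> E \<noteq> {}"
    using E measure_pmf_zero_iff[of p E] by auto
  let ?q = "cond_pmf p E"
  have int: "integrable (measure_pmf ?q) f" for f :: "'a \<Rightarrow> real"
    by (rule integrable_measure_pmf_finite) (use fin ne in auto)
  \<comment> \<open>Above the threshold a, with x = a + t, this combines (a + t)^2 \<le> 2 a^2 + 2
    t^2 with t^2 \<le> 2 exp t. The exponential term is later worth at most 4 in conditional
    expectation.\<close>
  have pt: "x\<^sup>2 \<le> 2 * a\<^sup>2 + 4 * exp (- a) * exp x" if x: "x \<ge> 0" for x :: real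
  proof (cases "x \<le> a")
    case True
    then have "x\<^sup>2 \<le> a\<^sup>2" using x by (rule power_mono)
    then show ?thesis by (smt (verit) exp_gt_zero mult_pos_pos zero_le_power2)
  next
    case False
    define t where "t = x - a"
    have t: "t > 0" using False by (simp add: t_def)
    have "x\<^sup>2 = (a + t)\<^sup>2" by (simp add: t_def)
    also have "\<dots> \<le> 2 * a\<^sup>2 + 2 * t\<^sup>2"
      using zero_le_power2[of "a - t"] by (simp add: power2_eq_square algebra_simps)
    also have "t\<^sup>2 \<le> 2 * exp t"
      using exp_lower_Taylor_quadratic[of t] t by simp
    also have "exp t = exp (- a) * exp x"
      by (simp add: t_def exp_add[symmetric])
    finally show ?thesis by simp
  qed
  have "measure_pmf.expectation ?q (\<lambda>x. (X x)\<^sup>2) \<le> measure_pmf.expectation ?q (\<lambda>x. 2 * a\<^sup>2 + 4 * exp (- a) * exp (X x))"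
    by (intro integral_mono int pt X)
  also have "\<dots> = 2 * a\<^sup>2 + 4 * exp (- a) * measure_pmf.expectation ?q (\<lambda>x. exp (X x))"
    using int by simp
  also have "measure_pmf.expectation ?q (\<lambda>x. exp (X x)) \<le> exp a"
  proof -
    have "measure_pmf.expectation ?q (\<lambda>x. exp (X x))
        \<le> measure_pmf.expectation p (\<lambda>x. exp (X x)) / measure_pmf.prob p E"
      by (rule expectation_cond_pmf_le[OF fin E]) simp
    also have "\<dots> \<le> exp a"
      using M E by (simp add: pos_divide_le_eq)
    finally show ?thesis .
  qed
  finally show ?thesis by (simp add: mult.assoc exp_add[symmetric])
qed

text \<open>\<open>Max\<close> is informative only on a finite set. Conditioning on the event {(u,
  u)} gives a point mass that violates the bound, so an admissible q satisfies q^2 < 1 / Pr(u, u),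
  which leaves finitely many.\<close>

lemma SDA_ge:
  fixes \<mu> :: "'u pmf"
  assumes fin: "finite (set_pmf \<mu>)" and u: "u \<in> set_pmf \<mu>"
    and uu: "\<bar>likelihood_corr M D0 D u u - 1\<bar> > 1 / real n"
    and q: "0 < q"
    and good: "\<And>E. measure_pmf.prob (pair_pmf \<mu> \<mu>) E \<ge> 1 / (real q)\<^sup>2 \<Longrightarrow>
        measure_pmf.expectation (cond_pmf (pair_pmf \<mu> \<mu>) E)
          (\<lambda>(u, v). \<bar>likelihood_corr M D0 D u v - 1\<bar>) \<le> 1 / real n"
  shows "SDA M D0 D \<mu> n \<ge> q"
proof -
  let ?p = "pair_pmf \<mu> \<mu>"
  let ?f = "\<lambda>(u, v). \<bar>likelihood_corr M D0 D u v - 1\<bar>"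
  let ?Q = "{q :: nat. 0 < q \<and> (\<forall>E. measure_pmf.prob ?p E \<ge> 1 / (real q)\<^sup>2 \<longrightarrow>
        measure_pmf.expectation (cond_pmf ?p E) ?f \<le> 1 / real n)}"
  let ?E = "{(u, u)}"
  have ne: "set_pmf ?p \<inter> ?E \<noteq> {}" using u by auto
  have pos: "measure_pmf.prob ?p ?E > 0"
    using ne by (simp add: measure_measure_pmf_not_zero zero_less_measure_iff)
  have "cond_pmf ?p ?E = return_pmf (u, u)"
    using ne by (simp flip: set_pmf_subset_singleton)
  then have bad: "measure_pmf.expectation (cond_pmf ?p ?E) ?f > 1 / real n"
    using uu by simp
  obtain N :: nat where N: "1 / measure_pmf.prob ?p ?E < real N"
    using reals_Archimedean2 by blast
  have "?Q \<subseteq> {..N}"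
  proof
    fix r assume r: "r \<in> ?Q"
    then have "\<not> measure_pmf.prob ?p ?E \<ge> 1 / (real r)\<^sup>2"
      using bad by force
    then have "(real r)\<^sup>2 < 1 / measure_pmf.prob ?p ?E"
      using pos r by (simp add: field_simps)
    also have "\<dots> < real N" by (rule N)
    also have "real N \<le> real (N\<^sup>2)" unfolding of_nat_le_iff power2_eq_square by (rule le_square)
    finally have "r < N" by (simp add: power2_less_imp_less flip: of_nat_power)
    then show "r \<in> {..N}" by simp
  qed
  then have "finite ?Q" using finite_subset by blast
  moreover have "q \<in> ?Q" using q good by blast
  ultimately show ?thesis unfolding SDA_def by (rule Max_ge)
qed

section \<open>Support, normalisation and overlaps of the spike prior\<close>

lemma set_spike_prior:
  assumes "k \<le> d"
  shows "set_pmf (spike_prior d k) = vCons (- 1 / sqrt (real k + 1)) ` sparse_sign_vectors d k"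
    and "finite (sparse_sign_vectors d k)" and "sparse_sign_vectors d k \<noteq> {}"
proof -
  show fin: "finite (sparse_sign_vectors d k)" by (rule sum_sparse_sign_vectors)
  \<comment> \<open>\<open>pmf_of_set\<close> is the uniform law only on a finite non-empty set; k
    \<le> d makes the count positive.\<close>
  have "card (sparse_sign_vectors d k) \<noteq> 0"
    using assms by (simp add: card_sparse_sign_vectors)
  then show ne: "sparse_sign_vectors d k \<noteq> {}" by force
  show "set_pmf (spike_prior d k) = vCons (- 1 / sqrt (real k + 1)) ` sparse_sign_vectors d k"
    by (simp add: spike_prior_def set_pmf_of_set[OF ne fin])
qed

text \<open>The fixed first coordinates always agree and contribute 1 / (k + 1), which is the
  deterministic 1 in the rescaled overlap.\<close>

lemma scalar_prod_vCons_spike: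
  "vCons (- 1 / sqrt (real k + 1)) y \<bullet> vCons (- 1 / sqrt (real k + 1)) y' = (1 + (real k + 1) * (y \<bullet> y')) / (real k + 1)"
  by (simp add: field_simps)

lemma spike_prior_unit:
  assumes kd: "k \<le> d" and u: "u \<in> set_pmf (spike_prior d k)"
  shows "u \<in> carrier_vec (d + 1)" and "u \<bullet> u = 1"
proof -
  obtain y where y: "y \<in> sparse_sign_vectors d k" "u = vCons (- 1 / sqrt (real k + 1)) y"
    using u by (auto simp: set_spike_prior[OF kd])
  have dim: "y \<in> carrier_vec d" using y by (simp add: sparse_sign_vectors_def)
  then show "u \<in> carrier_vec (d + 1)" by (simp add: y)
  have "y \<bullet> y = (\<Sum>i<d. if y $ i \<noteq> 0 then 1 / (real k + 1) else 0)"
    using y dim unfolding scalar_prod_def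
    by (auto simp: sparse_sign_vectors_def lessThan_atLeast0 intro!: sum.cong)
  also have "\<dots> = real (card ({..<d} \<inter> {i. y $ i \<noteq> 0})) * (1 / (real k + 1))"
    by (subst sum.If_cases) auto
  also have "{..<d} \<inter> {i. y $ i \<noteq> 0} = {i. i < d \<and> y $ i \<noteq> 0}" by auto
  also have "card \<dots> = k" using y by (simp add: sparse_sign_vectors_def)
  finally have "(real k + 1) * (y \<bullet> y) = real k" by simp
  then show "u \<bullet> u = 1" unfolding y(2) scalar_prod_vCons_spike by simp
qed

text \<open>With S the rescaled overlap of the sparse parts, |1 + S| \<le> 1 + |S| costs the factor
  exp t, and exp (t |S|) \<le> exp (t S) + exp (-t S) costs the factor 2, since cosh is
  even.\<close>

lemma expectation_exp_spike_overlap_le: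
  assumes kd: "k \<le> d" "0 < d" and t: "t \<ge> 0"
  shows "measure_pmf.expectation (pair_pmf (spike_prior d k) (spike_prior d k))
      (\<lambda>(u, v). exp (t * ((real k + 1) * \<bar>u \<bullet> v\<bar>)))
    \<le> 2 * exp (t + real k ^ 2 / real d * (cosh t - 1))"
proof -
  let ?V = "sparse_sign_vectors d k"
  let ?N = "real (card ?V)"
  let ?K = "exp (real k ^ 2 / real d * (cosh t - 1))"
  note V = set_spike_prior(2,3)[OF kd(1)]
  let ?P = "pair_pmf (pmf_of_set ?V) (pmf_of_set ?V)"
  let ?g = "\<lambda>y y'. exp (t * \<bar>1 + (real k + 1) * (y \<bullet> y')\<bar>)"
  have N: "?N > 0" using V by (simp add: card_gt_0_iff)
  have abs: "(real k + 1) * \<bar>x / (real k + 1)\<bar> = \<bar>x\<bar>" for x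
    by (simp add: abs_mult field_simps)
  have "measure_pmf.expectation (pair_pmf (spike_prior d k) (spike_prior d k))
      (\<lambda>(u, v). exp (t * ((real k + 1) * \<bar>u \<bullet> v\<bar>)))
     = measure_pmf.expectation ?P (\<lambda>(y, y'). ?g y y')"
    unfolding spike_prior_def map_pair[symmetric] integral_map_pmf
    by (intro Bochner_Integration.integral_cong refl)
      (simp only: split_def fst_conv snd_conv scalar_prod_vCons_spike abs)
  also have "\<dots> = (\<Sum>x\<in>?V \<times> ?V. (case x of (y, y') \<Rightarrow> ?g y y') * pmf ?P x)"
    by (rule integral_measure_pmf_real) (use V in auto)
  also have "\<dots> = (\<Sum>y'\<in>?V. \<Sum>y\<in>?V. ?g y y') / ?N / ?N"
    unfolding sum.cartesian_product[symmetric]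
    by (subst sum.swap) (simp add: sum.cartesian_product' pmf_pair V sum_divide_distrib)
  also have "\<dots> \<le> (\<Sum>y'\<in>?V. 2 * exp t * (?N * ?K)) / ?N / ?N"
  proof (intro divide_right_mono sum_mono)
    fix y' assume y': "y' \<in> ?V"
    let ?S = "\<lambda>y. (real k + 1) * (y \<bullet> y')"
    have "(\<Sum>y\<in>?V. ?g y y') \<le> (\<Sum>y\<in>?V. exp t * (exp (t * ?S y) + exp (- t * ?S y)))"
    proof (rule sum_mono)
      fix y
      have "t * \<bar>1 + ?S y\<bar> \<le> t * (1 + \<bar>?S y\<bar>)"
        using t by (intro mult_left_mono) auto
      then have "?g y y' \<le> exp (t + t * \<bar>?S y\<bar>)" by (simp add: algebra_simps)
      also have "\<dots> \<le> exp t * (exp (t * ?S y) + exp (- t * ?S y))"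
        unfolding exp_add by (intro mult_left_mono) (auto simp: abs_if)
      finally show "?g y y' \<le> exp t * (exp (t * ?S y) + exp (- t * ?S y))" .
    qed
    also have "\<dots> = exp t * ((\<Sum>y\<in>?V. exp (t * ?S y)) + (\<Sum>y\<in>?V. exp (- t * ?S y)))"
      by (simp only: sum_distrib_left[symmetric] sum.distrib)
    also have "\<dots> \<le> exp t * (?N * ?K + ?N * ?K)"
      using sum_exp_scalar_prod_sparse_sign_vectors_le[OF kd y', of t]
        sum_exp_scalar_prod_sparse_sign_vectors_le[OF kd y', of "- t"]
      by (intro mult_left_mono add_mono) auto
    finally show "(\<Sum>y\<in>?V. ?g y y') \<le> 2 * exp t * (?N * ?K)" by simp
  qed (use N in auto)
  also have "\<dots> = 2 * exp (t + real k ^ 2 / real d * (cosh t - 1))"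
    using N by (simp add: exp_add)
  finally show ?thesis .
qed

section \<open>Elementary inequalities, the conditional second moment of the overlap, and the lower
  bound\<close>

lemma abs_scalar_prod_unit_le:
  fixes u v :: "real Matrix.vec"
  assumes "u \<in> carrier_vec m" "u \<bullet> u = 1" "v \<in> carrier_vec m" "v \<bullet> v = 1"
  shows "\<bar>u \<bullet> v\<bar> \<le> 1"
  using abs_sum_mult_unit_le[of "($) u" "{0..<m}" "($) v"] assms
  by (simp add: scalar_prod_def power2_eq_square)

text \<open>With y = \<theta>^2 x^2, sqrt (1 - y) \<ge> 1 - y gives 1 / sqrt (1 - y) - 1 \<le> y /
  (1 - y), and y \<le> \<theta>^2 keeps the denominator away from 0.\<close>

lemma abs_inverse_sqrt_minus_one_le:
  fixes \<theta> x :: real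
  assumes "\<bar>\<theta>\<bar> < 1" "\<bar>x\<bar> \<le> 1"
  shows "\<bar>1 / sqrt (1 - \<theta>\<^sup>2 * x\<^sup>2) - 1\<bar> \<le> x\<^sup>2 / (1 - \<theta>\<^sup>2)"
proof -
  define y where "y = \<theta>\<^sup>2 * x\<^sup>2"
  have x2: "x\<^sup>2 \<le> 1" and t2: "\<theta>\<^sup>2 < 1" using assms by (auto simp: abs_square_le_1 abs_square_less_1)
  have "\<theta>\<^sup>2 * x\<^sup>2 \<le> \<theta>\<^sup>2 * 1" by (rule mult_left_mono) (use x2 in auto)
  then have y: "0 \<le> y" "y \<le> \<theta>\<^sup>2" "y < 1" using t2 by (auto simp: y_def)
  have s: "sqrt (1 - y) > 0" "sqrt (1 - y) \<le> 1" using y by auto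
  have "(1 - y)\<^sup>2 \<le> 1 - y" using y by (simp add: power2_eq_square mult_left_le)
  then have "1 - y \<le> sqrt (1 - y)" using y by (intro real_le_rsqrt)
  then have "1 / sqrt (1 - y) \<le> 1 / (1 - y)" using y by (intro divide_left_mono) auto
  also have "\<dots> = 1 + y / (1 - y)" using y by (simp add: field_simps)
  finally have "1 / sqrt (1 - y) - 1 \<le> y / (1 - y)" by simp
  also have "\<dots> \<le> y / (1 - \<theta>\<^sup>2)" using y t2 by (intro divide_left_mono) auto
  also have "\<dots> \<le> x\<^sup>2 / (1 - \<theta>\<^sup>2)"
  proof (rule divide_right_mono)
    show "y \<le> x\<^sup>2" unfolding y_def by (rule mult_left_le_one_le) (use t2 in auto)
  qed (use t2 in simp)
  finally show ?thesis using s unfolding y_def[symmetric] by (simp add: abs_of_nonneg)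
qed

lemma cosh_minus_one_le_square:
  fixes t :: real
  assumes "0 \<le> t" "t \<le> 1"
  shows "cosh t - 1 \<le> t\<^sup>2"
proof -
  \<comment> \<open>The product equals 1 + t^3; together with 1 + t \<le> exp t this bounds exp (-t)
    from above.\<close>
  have "1 \<le> (1 - t + t\<^sup>2) * (1 + t)"
    using assms by (simp add: algebra_simps power2_eq_square)
  also have "\<dots> \<le> (1 - t + t\<^sup>2) * exp t"
    using assms by (intro mult_left_mono exp_ge_add_one_self) auto
  finally have "exp (- t) \<le> 1 - t + t\<^sup>2"
    by (simp add: exp_minus field_simps)
  moreover have "exp t \<le> 1 + t + t\<^sup>2" using exp_bound[OF assms] .
  ultimately have "exp t + exp (- t) \<le> (1 - t + t\<^sup>2) + (1 + t + t\<^sup>2)" by linarith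
  then have "(exp t + exp (- t)) / 2 \<le> 1 + t\<^sup>2" by (subst pos_divide_le_eq) auto
  then show ?thesis unfolding cosh_field_def by (rule diff_le_eq[THEN iffD2, OF order_trans]) simp
qed

text \<open>The conditional square bound is applied to \<open>X\<close>, the overlap rescaled by t
  (k + 1), with a = 7K; dividing by t^2 k^2 gives the claim. The bound on q makes the probability of
  E at least exp (-2 (1 + K)).\<close>

lemma expectation_cond_spike_overlap_square_le:
  fixes K :: real and q :: nat
  assumes kd: "k \<le> d" "0 < k" and K: "1 \<le> K" and q: "0 < q" "real q \<le> exp (1 + K)"
    and E: "measure_pmf.prob (pair_pmf (spike_prior d k) (spike_prior d k)) E \<ge> 1 / (real q)\<^sup>2"
  shows "measure_pmf.expectation (cond_pmf (pair_pmf (spike_prior d k) (spike_prior d k)) E)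
      (\<lambda>(u, v). (u \<bullet> v)\<^sup>2) \<le> 102 / min (d / K) ((real k / K)\<^sup>2)"
proof -
  let ?p = "pair_pmf (spike_prior d k) (spike_prior d k)"
  \<comment> \<open>The largest t \<le> 1 with t^2 k^2 / d \<le> K: the exponential moment then
    stays of order exp K, and t \<le> 1 permits the quadratic bound on cosh.\<close>
  define t where "t = min 1 (sqrt (K * d) / k)"
  define X where "X = (\<lambda>(u, v). t * ((real k + 1) * \<bar>u \<bullet> v\<bar>))"
  have d: "0 < d" using kd by simp
  have t: "0 < t" "t \<le> 1" using kd K d by (auto simp: t_def)
  have fin: "finite (set_pmf ?p)"
    using set_spike_prior[OF kd(1)] by simp
  have pos: "measure_pmf.prob ?p E > 0"
    by (rule less_le_trans[OF _ E]) (use q in simp)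
  have t2: "t\<^sup>2 * (real k)\<^sup>2 = min ((real k)\<^sup>2) (K * d)"
  proof (cases "sqrt (K * d) / k \<le> 1")
    case True
    then have "sqrt (K * d) \<le> k" using kd by simp
    then have "(sqrt (K * d))\<^sup>2 \<le> (real k)\<^sup>2" by (rule power_mono) (use K in simp)
    then show ?thesis using True K kd by (simp add: t_def power_divide)
  next
    case False
    then have "real k \<le> sqrt (K * d)" using kd by (simp add: field_simps)
    then have "(real k)\<^sup>2 \<le> (sqrt (K * d))\<^sup>2" by (rule power_mono) simp
    then show ?thesis using False K kd by (simp add: t_def)
  qed
  have "(real k)\<^sup>2 / d * (cosh t - 1) \<le> (real k)\<^sup>2 / d * t\<^sup>2"
    using t by (intro mult_left_mono cosh_minus_one_le_square) auto
  also have "\<dots> = t\<^sup>2 * (real k)\<^sup>2 / d" by simp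
  also have "\<dots> \<le> K"
    unfolding t2 using d by (simp add: field_simps)
  finally have "t + (real k)\<^sup>2 / d * (cosh t - 1) \<le> 1 + K" using t by simp
  then have "2 * exp (t + (real k)\<^sup>2 / d * (cosh t - 1)) \<le> exp 1 * exp (1 + K)"
    using exp_ge_add_one_self[of 1] by (intro mult_mono) auto
  \<comment> \<open>The exponents compare as 2 + K \<le> 7K - 2 (1 + K), which is exactly K \<ge> 1;
    this fixes the constant 7.\<close>
  also have "\<dots> \<le> exp (7 * K) * exp (- (2 * (1 + K)))"
    unfolding exp_add[symmetric] using K by simp
  also have "\<dots> \<le> exp (7 * K) * measure_pmf.prob ?p E"
  proof (rule mult_left_mono)
    have "(real q)\<^sup>2 \<le> (exp (1 + K))\<^sup>2" using q by (intro power_mono) auto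
    then have "1 / exp (2 * (1 + K)) \<le> 1 / (real q)\<^sup>2"
      unfolding exp_double using q by (intro divide_left_mono) auto
    also have "1 / exp (2 * (1 + K)) = exp (- (2 * (1 + K)))"
      by (simp only: exp_minus inverse_eq_divide)
    finally show "exp (- (2 * (1 + K))) \<le> measure_pmf.prob ?p E"
      using E by (rule order_trans)
  qed simp
  finally have "2 * exp (t + (real k)\<^sup>2 / d * (cosh t - 1)) \<le> exp (7 * K) * measure_pmf.prob ?p E" .
  moreover have expX: "(\<lambda>x. exp (X x)) = (\<lambda>(u, v). exp (t * ((real k + 1) * \<bar>u \<bullet> v\<bar>)))"
    by (auto simp: X_def)
  ultimately have "measure_pmf.expectation ?p (\<lambda>x. exp (X x)) \<le> exp (7 * K) * measure_pmf.prob ?p E"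
    using expectation_exp_spike_overlap_le[OF kd(1) d, of t] t expX by simp
  then have X2: "measure_pmf.expectation (cond_pmf ?p E) (\<lambda>x. (X x)\<^sup>2) \<le> 2 * (7 * K)\<^sup>2 + 4"
    by (intro expectation_cond_pmf_square_le[OF fin pos])
      (use t K in \<open>auto simp: X_def\<close>)
  have ne: "set_pmf ?p \<inter> E \<noteq> {}"
    using pos measure_pmf_zero_iff[of ?p E] by auto
  have int: "integrable (measure_pmf (cond_pmf ?p E)) f" for f :: "_ \<Rightarrow> real"
    by (rule integrable_measure_pmf_finite) (use fin ne in auto)
  have "t\<^sup>2 * (real k)\<^sup>2 * measure_pmf.expectation (cond_pmf ?p E) (\<lambda>(u, v). (u \<bullet> v)\<^sup>2)
    = measure_pmf.expectation (cond_pmf ?p E) (\<lambda>x. t\<^sup>2 * (real k)\<^sup>2 * (case x of (u, v) \<Rightarrow> (u \<bullet> v)\<^sup>2))"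
    by simp
  also have "\<dots> \<le> measure_pmf.expectation (cond_pmf ?p E) (\<lambda>x. (X x)\<^sup>2)"
  proof (intro integral_mono int)
    have "t\<^sup>2 * (real k)\<^sup>2 * r\<^sup>2 \<le> (t * ((real k + 1) * \<bar>r\<bar>))\<^sup>2" for r
    proof -
      have "(real k)\<^sup>2 \<le> (real k + 1)\<^sup>2" by (rule power_mono) auto
      then have "(real k)\<^sup>2 * (t\<^sup>2 * r\<^sup>2) \<le> (real k + 1)\<^sup>2 * (t\<^sup>2 * r\<^sup>2)"
        by (rule mult_right_mono) simp
      then show ?thesis by (simp add: power_mult_distrib mult_ac)
    qed
    then show "t\<^sup>2 * (real k)\<^sup>2 * (case x of (u, v) \<Rightarrow> (u \<bullet> v)\<^sup>2) \<le> (X x)\<^sup>2" for x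
      by (simp only: X_def split: prod.split) blast
  qed
  also have "\<dots> \<le> 2 * (7 * K)\<^sup>2 + 4" by (rule X2)
  \<comment> \<open>102 = 2 * 7^2 + 4, using K \<ge> 1.\<close>
  also have "\<dots> \<le> 102 * K\<^sup>2"
    using one_le_power[OF K, of 2] by simp
  finally have "t\<^sup>2 * (real k)\<^sup>2 * measure_pmf.expectation (cond_pmf ?p E) (\<lambda>(u, v). (u \<bullet> v)\<^sup>2) \<le> 102 * K\<^sup>2" .
  moreover have "t\<^sup>2 * (real k)\<^sup>2 = K\<^sup>2 * min (d / K) ((real k / K)\<^sup>2)"
    unfolding t2 using K by (simp add: min_mult_distrib_left power_divide power2_eq_square min.commute)
  moreover have "min (d / K) ((real k / K)\<^sup>2) > 0" using kd d K by simp
  ultimately show ?thesis using K by (simp add: field_simps)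
qed

text \<open>The non-asymptotic form, with K in place of k^\<delta>. The premise \<open>bound\<close>
  pushes the conditional correlation below 1/n, while \<open>large\<close> makes the diagonal event
  violate that bound, so that the maximum defining SDA exists.\<close>

lemma NegSPCA_SDA_ge:
  fixes \<theta> K :: real
  assumes \<theta>: "0 < \<theta>" "\<theta> < 1" and kd: "k \<le> d" "0 < k" and K: "1 \<le> K" and n: "0 < n"
    and bound: "102 / (1 - \<theta>\<^sup>2) * real n \<le> min (d / K) ((real k / K)\<^sup>2)"
    and large: "1 / real n < 1 / sqrt (1 - \<theta>\<^sup>2) - 1"
  shows "2 powr K \<le> real (NegSPCA_SDA \<theta> d k n)"
proof -
  \<comment> \<open>SDA ranges over naturals, so 2^K is rounded up. The rounding is harmless: q
    \<le> 2^K + 1 \<le> 2 exp K \<le> exp (1 + K).\<close>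
  define q where "q = nat \<lceil>2 powr K\<rceil>"
  let ?\<mu> = "spike_prior d k"
  let ?p = "pair_pmf ?\<mu> ?\<mu>"
  let ?M = "min (d / K) ((real k / K)\<^sup>2)"
  let ?corr = "likelihood_corr (lebesgue_space (d + 1)) (gaussian_density (1\<^sub>m (d + 1)))
     (\<lambda>x. gaussian_density (spiked_covariance \<theta> x))"
  have \<theta>2: "\<theta>\<^sup>2 < 1" using \<theta> by (simp add: abs_square_less_1)
  have corr: "?corr u v = 1 / sqrt (1 - \<theta>\<^sup>2 * (u \<bullet> v)\<^sup>2)" if "u \<in> set_pmf ?\<mu>" "v \<in> set_pmf ?\<mu>" for u v
    using that by (intro likelihood_corr_spiked spike_prior_unit \<theta>) (use kd in auto)
  have K0: "2 powr K \<ge> 1" using K by (simp add: ge_one_powr_ge_zero)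
  have q_ge: "2 powr K \<le> real q" unfolding q_def by linarith
  have q0: "0 < q" using q_ge K0 by (cases q) auto
  have "2 powr K \<le> exp K"
    using K ln_le_minus_one[of 2] by (simp add: powr_def mult_left_le)
  moreover have "real q \<le> 2 powr K + 1" unfolding q_def using K0 by linarith
  ultimately have "real q \<le> 2 * exp K" using K0 by linarith
  also have "\<dots> \<le> exp 1 * exp K" using exp_ge_add_one_self[of 1] by simp
  finally have q_le: "real q \<le> exp (1 + K)" by (simp add: exp_add)
  have M: "?M > 0" using kd K by simp
  obtain u where u: "u \<in> set_pmf ?\<mu>" using set_pmf_not_empty by fast
  have "SDA (lebesgue_space (d + 1)) (gaussian_density (1\<^sub>m (d + 1)))
       (\<lambda>x. gaussian_density (spiked_covariance \<theta> x)) ?\<mu> n \<ge> q"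
  proof (rule SDA_ge)
    show "finite (set_pmf ?\<mu>)" using set_spike_prior[OF kd(1)] by simp
    show "u \<in> set_pmf ?\<mu>" by (rule u)
    show "1 / real n < \<bar>?corr u u - 1\<bar>"
      using large unfolding corr[OF u u] spike_prior_unit(2)[OF kd(1) u] by simp
    show "0 < q" by (rule q0)
    fix E assume E: "measure_pmf.prob ?p E \<ge> 1 / (real q)\<^sup>2"
    have pos: "measure_pmf.prob ?p E > 0"
      by (rule less_le_trans[OF _ E]) (use q0 in simp)
    have ne: "set_pmf ?p \<inter> E \<noteq> {}"
      using pos measure_pmf_zero_iff[of ?p E] by auto
    have int: "integrable (measure_pmf (cond_pmf ?p E)) f" for f :: "_ \<Rightarrow> real"
      by (rule integrable_measure_pmf_finite) (use ne set_spike_prior[OF kd(1)] in auto)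
    have "measure_pmf.expectation (cond_pmf ?p E) (\<lambda>(u, v). \<bar>?corr u v - 1\<bar>)
      \<le> measure_pmf.expectation (cond_pmf ?p E) (\<lambda>x. (case x of (u, v) \<Rightarrow> (u \<bullet> v)\<^sup>2) / (1 - \<theta>\<^sup>2))"
    \<comment> \<open>The comparison of the correlation with the squared overlap relies on unit
      vectors, hence is made only on the support of the prior.\<close>
    proof (rule integral_mono_AE[OF int int])
      show "AE x in cond_pmf ?p E. (case x of (u, v) \<Rightarrow> \<bar>?corr u v - 1\<bar>)
          \<le> (case x of (u, v) \<Rightarrow> (u \<bullet> v)\<^sup>2) / (1 - \<theta>\<^sup>2)"
        unfolding AE_measure_pmf_iff set_cond_pmf[OF ne]
      proof safe
        fix u v assume "(u, v) \<in> set_pmf ?p"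
        then have uv: "u \<in> set_pmf ?\<mu>" "v \<in> set_pmf ?\<mu>" by auto
        have "\<bar>u \<bullet> v\<bar> \<le> 1"
          using spike_prior_unit[OF kd(1) uv(1)] spike_prior_unit[OF kd(1) uv(2)]
          by (rule abs_scalar_prod_unit_le)
        then show "\<bar>?corr u v - 1\<bar> \<le> (u \<bullet> v)\<^sup>2 / (1 - \<theta>\<^sup>2)"
          unfolding corr[OF uv] using \<theta> by (intro abs_inverse_sqrt_minus_one_le) auto
      qed
    qed
    also have "\<dots> = measure_pmf.expectation (cond_pmf ?p E) (\<lambda>(u, v). (u \<bullet> v)\<^sup>2) / (1 - \<theta>\<^sup>2)"
      by simp
    also have "\<dots> \<le> 102 / ?M / (1 - \<theta>\<^sup>2)"
      using \<theta>2 expectation_cond_spike_overlap_square_le[OF kd K q0 q_le E] by (intro divide_right_mono) auto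
    also have "\<dots> \<le> 1 / real n"
    proof -
      have "102 / (1 - \<theta>\<^sup>2) \<le> ?M / real n" using bound n by (simp add: pos_le_divide_eq)
      moreover have "102 / m / c \<le> 1 / n'" if "102 / c \<le> m / n'" "0 < m" for m c n' :: real
        using divide_right_mono[OF that(1), of m] that(2) by (simp add: mult.commute)
      ultimately show ?thesis using M by blast
    qed
    finally show "measure_pmf.expectation (cond_pmf ?p E) (\<lambda>(u, v). \<bar>?corr u v - 1\<bar>) \<le> 1 / real n" .
  qed
  then show ?thesis using q_ge unfolding NegSPCA_SDA_def by linarith
qed

theorem theoremC6:
  fixes \<delta> \<theta> :: real and d k :: "nat \<Rightarrow> nat"
  assumes "0 < \<delta>" and "\<delta> \<le> 1 / 10"
    and "0 < \<theta>" and "\<theta> < 1"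
    and "\<And>n. k n \<le> d n"
    and "(\<lambda>n. real n) \<in> o[sequentially](\<lambda>n.
           min (real (d n) / real (k n) powr \<delta>) (real (k n) powr (2 - 2 * \<delta>)))"
  shows "\<forall>\<^sub>F n in sequentially.
           real (NegSPCA_SDA \<theta> (d n) (k n) n) \<ge> 2 powr (real (k n) powr \<delta>)"
proof -
  let ?M = "\<lambda>n. min (real (d n) / real (k n) powr \<delta>) (real (k n) powr (2 - 2 * \<delta>))"
  define C where "C = 102 / (1 - \<theta>\<^sup>2)"
  have \<theta>2: "0 < \<theta>\<^sup>2" "\<theta>\<^sup>2 < 1" using assms(3,4) by (auto simp: abs_square_less_1)
  then have C: "C > 0" by (simp add: C_def)
  have "sqrt (1 - \<theta>\<^sup>2) < 1" "sqrt (1 - \<theta>\<^sup>2) > 0" using \<theta>2 by auto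
  then have gap: "1 / sqrt (1 - \<theta>\<^sup>2) - 1 > 0" by simp
  \<comment> \<open>The little-o hypothesis is used only at the constant 1 / C, turning it into C n
    \<le> \<open>?M n\<close> eventually.\<close>
  have "\<forall>\<^sub>F n in sequentially. norm (real n) \<le> (1 / C) * norm (?M n)"
    using C by (intro landau_o.smallD[OF assms(6)]) simp
  moreover have "\<forall>\<^sub>F n in sequentially. 1 / real n < 1 / sqrt (1 - \<theta>\<^sup>2) - 1"
    using order_tendstoD(2)[OF lim_1_over_n gap] by simp
  moreover have "\<forall>\<^sub>F n in sequentially. 0 < n" by (rule eventually_gt_at_top)
  ultimately show ?thesis
  proof eventually_elim
    case (elim n)
    have "?M n \<ge> 0" by simp
    then have n: "C * real n \<le> ?M n"
      using elim(1) C by (simp add: field_simps)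
    \<comment> \<open>For k = 0 both terms of the minimum vanish, as 0 powr \<delta> = 0 and
      division by 0 yields 0; this contradicts n > 0.\<close>
    have k: "0 < k n"
    proof (rule ccontr)
      assume "\<not> 0 < k n"
      then have "?M n = 0" by simp
      moreover have "C * real n > 0" using C elim(3) by simp
      ultimately show False using n by linarith
    qed
    let ?K = "real (k n) powr \<delta>"
    have K: "?K \<ge> 1" using k assms(1) by (intro ge_one_powr_ge_zero) auto
    \<comment> \<open>Matches the second term of the growth condition with the (k / K)^2 of the
      non-asymptotic bound at K = k^\<delta>.\<close>
    have "real (k n) powr (2 - 2 * \<delta>) = (real (k n) / ?K)\<^sup>2"
      using k by (simp add: powr_diff powr_realpow power_divide powr_powr[symmetric] mult.commute[of 2])
    then show ?case
      using NegSPCA_SDA_ge[OF assms(3,4) assms(5)[of n] k K elim(3) _ elim(2)] n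
      unfolding C_def by simp
  qed
qed

end
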